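(* Let $1\le m<n$ and let $\gamma_1,\dots,\gamma_d$ be $d$ disjoint pieces of $(n-m)$-dimensional analytic manifold in $\mathbb C^n$. Suppose that for any $(\alpha,\beta)\in(\mathbb C^m)^{n-m}\times\mathbb C^{n-m}$ close to $(0,0)$, the affine $m$-dimensional subspace $$L_{\alpha,\beta}:=\Big\{\zeta\in\mathbb C^n:\ \zeta_k=\sum_{r=1}^m\alpha_{k,r}\,\zeta_{n-m+r}+\beta_k,\ k=1,\dots,n-m\Big\}$$ intersects $\gamma_1,\dots,\gamma_d$ transversally, respectively at points $p_1(\alpha,\beta),\dots,p_d(\alpha,\beta)$. Assume that there exist $D\in\mathbb N$ and analytic functions $h^{(l)}_{\underline k}$ ($\underline k\in\mathbb N^{n-m}$, $|\underline k|\le D+1$, $l=n-m+1,\dots,n$) in a neighborhood of $0$ in $(\mathbb C^m)^{n-m}$ such that, for $(\alpha,\beta)$ close to $(0,0)$ and for any $l=n-m+1,\dots,n$, $$\sum_{j=1}^d\zeta_l[p_j(\alpha,\beta)]=\sum_{\substack{\underline k\in\mathbb N^{n-m}\\|\underline k|\le D+1}}h^{(l)}_{\underline k}(\alpha)\,\beta_1^{k_1}\cdots\beta_{n-m}^{k_{n-m}} .$$ Then one can find a collection of polynomials $(P_\iota)_{\iota\in\mathcal J}$ in $\mathbb C[X_1,\dots,X_n]$ of degree at most $d+D$, with common zero set $V(P)\subset\mathbb C^n$, and constants $\epsilon>0$, $\kappa>0$, $K>0$ such that: (i) if $\Gamma_\epsilon:=\bigcup_{\max(\|\alpha\|,\|\beta\|)<\epsilon}L_{\alpha,\beta}$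 (union over $(\alpha,\beta)\in(\mathbb C^m)^{n-m}\times\mathbb C^{n-m}$), then $$\zeta\in\Gamma_\epsilon,\ \|\zeta\|\ge K\ \Longrightarrow\ \max_{\iota\in\mathcal J}|P_\iota(\zeta)|\ge\kappa\|\zeta\|^d;$$ (ii) for $\max(\|\alpha\|,\|\beta\|)<\epsilon$, $\ L_{\alpha,\beta}\cap V(P)=\{p_1(\alpha,\beta),\dots,p_d(\alpha,\beta)\}$.
   Context: A "piece of manifold" is a (germ-like, small) locally closed complex submanifold of $\mathbb C^n$. For a point $p\in\mathbb C^n$, $\zeta_l[p]$ denotes its $l$-th affine coordinate. For a multi-index $\underline k$, $|\underline k|=\sum k_i$. *)

theory Defs
  imports "HOL-Analysis.Analysis" "HOL-Library.Poly_Mapping" "HOL-Library.Disjoint_Sets"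
begin

text \<open>
  The finite types \<open>'q\<close> and \<open>'m\<close> index the first \<open>n - m\<close> and the last \<open>m\<close> coordinates, so
  that \<open>m = CARD('m)\<close>, \<open>n - m = CARD('q)\<close> and \<open>\<complex>\<^sup>n\<close> is \<open>complex ^ ('q + 'm)\<close>. As types are nonempty,
  \<open>1 \<le> m < n\<close> holds automatically. The parameter \<open>\<alpha>\<close> in \<open>(\<complex>\<^sup>m)\<^bsup>n - m\<^esup>\<close> is a vector of type
  \<open>complex ^ ('q \<times> 'm)\<close>, with entry \<open>\<alpha> $ (k, r)\<close> for \<open>\<alpha>\<^bsub>k,r\<^esub>\<close>; all norms are Euclidean.
\<close>

definition L :: "complex ^ ('q \<times> 'm) \<Rightarrow> complex ^ 'q \<Rightarrow> (complex ^ ('q::finite + 'm::finite)) set"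
  where "L \<alpha> \<beta> = {\<zeta>. \<forall>k. \<zeta> $ Inl k = (\<Sum>r\<in>UNIV. \<alpha> $ (k, r) * \<zeta> $ Inr r) + \<beta> $ k}"

definition Gamma_cone :: "real \<Rightarrow> (complex ^ ('q::finite + 'm::finite)) set"
  where "Gamma_cone \<epsilon> = (\<Union>(\<alpha>, \<beta>) \<in> {(\<alpha>, \<beta>). max (norm \<alpha>) (norm \<beta>) < \<epsilon>}. L \<alpha> \<beta>)"


section \<open>Complex submanifolds and transversality\<close>

text \<open>Holomorphy in several variables: real Frechet derivative which is complex linear.
  On an open set this is the same as being complex analytic.\<close>

definition mv_holomorphic_on :: "(complex ^ 'a::finite \<Rightarrow> complex) \<Rightarrow> (complex ^ 'a) set \<Rightarrow> bool"
  where "mv_holomorphic_on f U \<longleftrightarrow>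
    (\<forall>z\<in>U. \<exists>f'. (f has_derivative f') (at z) \<and> (\<forall>c v. f' (c *s v) = c * f' v))"

definition biholomorphism ::
  "(complex ^ 'a::finite) set \<Rightarrow> (complex ^ 'a) set \<Rightarrow>
    (complex ^ 'a \<Rightarrow> complex ^ 'a) \<Rightarrow> (complex ^ 'a \<Rightarrow> complex ^ 'a) \<Rightarrow> bool"
  where "biholomorphism U V \<phi> \<psi> \<longleftrightarrow>
    open U \<and> open V \<and> \<phi> ` U = V \<and> \<psi> ` V = U \<and>
    (\<forall>x\<in>U. \<psi> (\<phi> x) = x) \<and> (\<forall>y\<in>V. \<phi> (\<psi> y) = y) \<and>
    (\<forall>i. mv_holomorphic_on (\<lambda>x. \<phi> x $ i) U) \<and> (\<forall>i. mv_holomorphic_on (\<lambda>y. \<psi> y $ i) V)"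

text \<open>Embedded submanifolds of dimension \<open>k\<close>, given by local straightenings to a coordinate
  \<open>k\<close>-plane. Such sets are automatically locally closed.\<close>

definition complex_submanifold :: "nat \<Rightarrow> (complex ^ 'a::finite) set \<Rightarrow> bool"
  where "complex_submanifold k S \<longleftrightarrow>
    (\<forall>p\<in>S. \<exists>U (V :: (complex ^ 'a) set) \<phi> \<psi> I. p \<in> U \<and> biholomorphism U V \<phi> \<psi> \<and> card I = k \<and>
       \<phi> ` (S \<inter> U) = {z\<in>V. \<forall>i. i \<notin> I \<longrightarrow> z $ i = 0})"

text \<open>Velocities at \<open>x\<close> of curves in \<open>S\<close>. For a submanifold this is the usual tangent space.\<close>

definition tangent_space :: "'a::real_normed_vector set \<Rightarrow> 'a \<Rightarrow> 'a set"
  where "tangent_space S x =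
    {v. \<exists>c :: real \<Rightarrow> 'a. c 0 = x \<and> (\<forall>\<^sub>F t in nhds 0. c t \<in> S) \<and>
          (c has_vector_derivative v) (at 0)}"

definition transversal_at :: "'a::real_normed_vector set \<Rightarrow> 'a set \<Rightarrow> 'a \<Rightarrow> bool"
  where "transversal_at S T x \<longleftrightarrow>
    {v + w |v w. v \<in> tangent_space S x \<and> w \<in> tangent_space T x} = UNIV"


section \<open>Polynomials in several variables\<close>

text \<open>A finitely supported map from monomials (finitely supported exponent maps) to
  coefficients.\<close>

type_synonym 'i cpoly = "('i \<Rightarrow>\<^sub>0 nat) \<Rightarrow>\<^sub>0 complex"

definition poly_eval :: "'i::finite cpoly \<Rightarrow> complex ^ 'i \<Rightarrow> complex"
  where "poly_eval P \<zeta> =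
    (\<Sum>e\<in>Poly_Mapping.keys P. Poly_Mapping.lookup P e *
       (\<Prod>i\<in>UNIV. (\<zeta> $ i) ^ Poly_Mapping.lookup e i))"

text \<open>The total degree; the inserted \<open>0\<close> only matters for the zero polynomial.\<close>

definition total_degree :: "'i::finite cpoly \<Rightarrow> nat"
  where "total_degree P =
    Max (insert 0 ((\<lambda>e. \<Sum>i\<in>UNIV. Poly_Mapping.lookup e i) ` Poly_Mapping.keys P))"

definition common_zeros :: "'j set \<Rightarrow> ('j \<Rightarrow> 'i::finite cpoly) \<Rightarrow> (complex ^ 'i) set"
  where "common_zeros J P = {\<zeta>. \<forall>\<iota>\<in>J. poly_eval (P \<iota>) \<zeta> = 0}"

end

theory Submission
  imports Defs "HOL-Computational_Algebra.Polynomial"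
begin

text \<open>
  Invariance of domain together with the uniqueness of the intersection points shows that each
  \<open>p\<^sub>j\<close> is complex differentiable, and since \<open>p\<^sub>j\<close> does not change when the plane is
  rotated about it, every linear form \<open>u\<^sub>j = x \<cdot> t(p\<^sub>j)\<close> in the last \<open>m\<close> coordinates solves
  a Burgers equation \<open>\<partial>\<^sub>w u\<^sub>j = u\<^sub>j \<partial>\<^sub>z u\<^sub>j\<close> along \<open>(\<alpha> + w b \<otimes> x, \<beta> + z b)\<close>. For the
  coefficients \<open>a\<^sub>N\<close> of \<open>\<Prod>\<^sub>j (s - u\<^sub>j)\<close> and the trace \<open>S\<close> this reads
  \<open>\<partial>\<^sub>z a\<^bsub>N+1\<^esub> = \<partial>\<^sub>w a\<^sub>N - (\<partial>\<^sub>z S) a\<^sub>N\<close>. If \<open>S\<close> had degree \<open>E \<ge> 2\<close> in \<open>z\<close> with top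
  coefficient \<open>c\<close>, then \<open>a\<^sub>N\<close> would have top term \<open>(-c)\<^sup>N z\<^bsup>NE\<^esup> / N!\<close>, contradicting
  \<open>a\<^bsub>d+1\<^esub> = 0\<close>. So \<open>S\<close> is affine and \<open>a\<^sub>N\<close> has degree at most \<open>N\<close>. Hence
  \<open>\<Prod>\<^sub>j (x \<cdot> t - u\<^sub>j(\<alpha>, \<zeta>' - \<alpha> t))\<close> is a polynomial in \<open>\<zeta> = (\<zeta>', t)\<close> of degree at most \<open>d\<close> for
  each \<open>(\<alpha>, x)\<close>. All these polynomials vanish at all the \<open>p\<^sub>j\<close>, and on \<open>L\<^bsub>\<alpha>,\<beta>\<^esub>\<close> those with
  parameter \<open>\<alpha>\<close> cut out exactly the \<open>p\<^sub>j(\<alpha>, \<beta>)\<close>. Gaussian elimination on the coefficients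
  selects a finite subfamily that controls all of them uniformly.
\<close>

section \<open>Polynomials in one variable\<close>

text \<open>Polynomiality only on \<open>A\<close>: the functions in question are meaningful only
  for small parameters, and nothing is claimed outside \<open>A\<close>.\<close>

definition pol_on :: "complex set \<Rightarrow> nat \<Rightarrow> (complex \<Rightarrow> complex) \<Rightarrow> bool"
  where "pol_on A M f \<longleftrightarrow> (\<exists>p. degree p \<le> M \<and> (\<forall>z\<in>A. f z = poly p z))"

lemma pol_onI: "degree p \<le> M \<Longrightarrow> (\<And>z. z \<in> A \<Longrightarrow> f z = poly p z) \<Longrightarrow> pol_on A M f"
  unfolding pol_on_def by blast

lemma pol_on_mono: "pol_on A M f \<Longrightarrow> M \<le> N \<Longrightarrow> pol_on A N f"
  unfolding pol_on_def using le_trans by blast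

lemma pol_on_const: "pol_on A M (\<lambda>_. c)"
  by (rule pol_onI[of "[:c:]"]) auto

lemma pol_on_add: "pol_on A M f \<Longrightarrow> pol_on A M g \<Longrightarrow> pol_on A M (\<lambda>z. f z + g z)"
  unfolding pol_on_def by (metis degree_add_le poly_add)

lemma pol_on_sum: "(\<And>i. i \<in> I \<Longrightarrow> pol_on A M (f i)) \<Longrightarrow> pol_on A M (\<lambda>z. \<Sum>i\<in>I. f i z)"
  by (induction I rule: infinite_finite_induct) (auto intro: pol_on_const pol_on_add)

lemma pol_on_mult: "pol_on A M f \<Longrightarrow> pol_on A N g \<Longrightarrow> pol_on A (M + N) (\<lambda>z. f z * g z)"
  unfolding pol_on_def by (metis add_mono degree_mult_le le_trans poly_mult)

lemma pol_on_cmult: "pol_on A M f \<Longrightarrow> pol_on A M (\<lambda>z. c * f z)"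
  using pol_on_mult[OF pol_on_const[of A 0 c], of M f] by simp

lemma pol_on_affine: "pol_on A (Suc 0) (\<lambda>z. a + z * b)"
  by (rule pol_onI[of "[:a, b:]"]) auto

lemma pol_on_power: "pol_on A M f \<Longrightarrow> pol_on A (M * k) (\<lambda>z. f z ^ k)"
proof (induction k)
  case 0
  then show ?case by (simp add: pol_on_const)
next
  case (Suc k)
  then show ?case using pol_on_mult[of A M f "M * k" "\<lambda>z. f z ^ k"] by simp
qed

lemma pol_on_prod:
  "(\<And>i. i \<in> I \<Longrightarrow> pol_on A (M i) (f i)) \<Longrightarrow> pol_on A (\<Sum>i\<in>I. M i) (\<lambda>z. \<Prod>i\<in>I. f i z)"
  by (induction I rule: infinite_finite_induct) (auto intro: pol_on_const pol_on_mult)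

lemma pol_on_cong: "pol_on A M f \<Longrightarrow> (\<And>z. z \<in> A \<Longrightarrow> g z = f z) \<Longrightarrow> pol_on A M g"
  unfolding pol_on_def by simp

lemma poly_eq_on_infinite:
  fixes p q :: "complex poly"
  assumes "infinite A" "\<And>z. z \<in> A \<Longrightarrow> poly p z = poly q z"
  shows "p = q"
proof (rule ccontr)
  assume "p \<noteq> q"
  then have "finite {z. poly (p - q) z = 0}" by (intro poly_roots_finite) simp
  moreover have "A \<subseteq> {z. poly (p - q) z = 0}" using assms(2) by auto
  ultimately show False using assms(1) finite_subset by blast
qed

lemma pol_on_subset: "pol_on A M f \<Longrightarrow> B \<subseteq> A \<Longrightarrow> pol_on B M f"
  unfolding pol_on_def by blast

lemma pol_on_eqI:
  assumes "pol_on UNIV M f" "pol_on UNIV N g" "infinite A" "\<And>z. z \<in> A \<Longrightarrow> f z = g z"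
  shows "f z = g z"
proof -
  obtain p q where "\<And>z. f z = poly p z" "\<And>z. g z = poly q z"
    using assms(1,2) unfolding pol_on_def by auto
  then show ?thesis using poly_eq_on_infinite[OF assms(3), of p q] assms(4) by simp
qed

text \<open>The nodes and the basis polynomials are chosen before \<open>f\<close>, so the formula
  is linear in \<open>f\<close> with fixed coefficients. Limits and bounds uniform over a family
  both rest on this.\<close>

lemma lagrange_interpolation:
  assumes "infinite A"
  obtains c :: "nat \<Rightarrow> complex" and l :: "nat \<Rightarrow> complex poly"
  where "\<And>j. c j \<in> A" "\<And>j. j \<le> M \<Longrightarrow> degree (l j) \<le> M"
    "\<And>f z. pol_on A M f \<Longrightarrow> z \<in> A \<Longrightarrow> f z = (\<Sum>j\<le>M. f (c j) * poly (l j) z)"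
proof -
  obtain c :: "nat \<Rightarrow> complex" where c: "inj c" "range c \<subseteq> A"
    using infinite_countable_subset[OF assms] by blast
  define l where "l j = (\<Prod>i\<in>{..M} - {j}. smult (1 / (c j - c i)) [:- c i, 1:])" for j
  have deg: "degree (l j) \<le> M" if "j \<le> M" for j
  proof -
    have "degree (l j) \<le> (\<Sum>i\<in>{..M} - {j}. degree (smult (1 / (c j - c i)) [:- c i, 1:]))"
      unfolding l_def by (rule degree_prod_sum_le[unfolded o_def]) auto
    also have "\<dots> \<le> (\<Sum>i\<in>{..M} - {j}. 1)"
      by (intro sum_mono order.trans[OF degree_smult_le]) auto
    finally show ?thesis using that by simp
  qed
  have kron: "poly (l j) (c i) = (if i = j then 1 else 0)" if "i \<le> M" for i j
  proof (cases "i = j")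
    case True
    have "c j - c i' \<noteq> 0" if "i' \<noteq> j" for i' using c(1) that by (auto dest: injD)
    then have "poly (l j) (c j) = (\<Prod>i\<in>{..M} - {j}. 1)"
      unfolding l_def poly_prod by (intro prod.cong) (auto simp: diff_divide_distrib[symmetric])
    then show ?thesis using True by simp
  next
    case False
    then show ?thesis using that unfolding l_def poly_prod
      by (auto intro!: bexI[of _ i])
  qed
  show thesis
  proof
    show "c j \<in> A" for j using c(2) by auto
    show "degree (l j) \<le> M" if "j \<le> M" for j using deg[OF that] .
    fix f z assume "pol_on A M f" "z \<in> A"
    then obtain p where p: "degree p \<le> M" "\<And>z. z \<in> A \<Longrightarrow> f z = poly p z"
      unfolding pol_on_def by blast
    let ?q = "\<Sum>j\<le>M. smult (f (c j)) (l j)"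
    have "p = ?q"
    proof (rule poly_eqI_degree[of "c ` {..M}"])
      fix x assume "x \<in> c ` {..M}"
      then obtain i where i: "i \<le> M" "x = c i" by blast
      have "poly ?q x = (\<Sum>j\<le>M. if i = j then f (c j) else 0)"
        unfolding poly_sum i(2) by (intro sum.cong) (auto simp: kron[OF i(1)])
      then show "poly p x = poly ?q x" using i p(2)[of x] c(2) by (auto simp: range_subsetD)
    next
      have card: "card (c ` {..M}) = Suc M"
        using card_image[OF inj_on_subset[OF c(1)], of "{..M}"] by simp
      show "degree p < card (c ` {..M})" using p(1) card by simp
      have "degree ?q \<le> M"
        by (intro degree_sum_le) (auto simp del: degree_smult_eq intro: order.trans[OF degree_smult_le deg])
      then show "degree ?q < card (c ` {..M})" using card by simp
    qed
    then show "f z = (\<Sum>j\<le>M. f (c j) * poly (l j) z)"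
      using p(2)[OF \<open>z \<in> A\<close>] by (simp add: poly_sum)
  qed
qed

text \<open>Pointwise convergence suffices, since a polynomial of degree at most \<open>M\<close> is
  a fixed linear combination of its values at \<open>M + 1\<close> nodes.\<close>

lemma pol_on_limit:
  assumes "infinite A" and pol: "\<And>n::nat. pol_on A M (f n)"
    and lim: "\<And>z. z \<in> A \<Longrightarrow> (\<lambda>n. f n z) \<longlonglongrightarrow> g z"
  shows "pol_on A M g"
proof -
  obtain c l where c: "\<And>j. c j \<in> A" and deg: "\<And>j. j \<le> M \<Longrightarrow> degree (l j) \<le> M"
    and repr: "\<And>f z. pol_on A M f \<Longrightarrow> z \<in> A \<Longrightarrow> f z = (\<Sum>j\<le>M. f (c j) * poly (l j) z)"
    using lagrange_interpolation[OF assms(1)] by metis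
  show ?thesis
  proof (rule pol_onI)
    show "degree (\<Sum>j\<le>M. smult (g (c j)) (l j)) \<le> M"
      by (intro degree_sum_le) (auto simp del: degree_smult_eq intro: order.trans[OF degree_smult_le deg])
    fix z assume z: "z \<in> A"
    have "(\<lambda>n. \<Sum>j\<le>M. f n (c j) * poly (l j) z) \<longlonglongrightarrow> (\<Sum>j\<le>M. g (c j) * poly (l j) z)"
      by (intro tendsto_intros lim c)
    then show "g z = poly (\<Sum>j\<le>M. smult (g (c j)) (l j)) z"
      using LIMSEQ_unique[OF lim[OF z]] repr[OF pol z] by (simp add: poly_sum)
  qed
qed

lemma poly_antiderivative:
  fixes q :: "complex poly"
  obtains Q :: "complex poly" where "pderiv Q = q"
proof
  show "pderiv (\<Sum>i\<le>degree q. monom (coeff q i / of_nat (Suc i)) (Suc i)) = q"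
    by (rule poly_eqI)
      (auto simp: coeff_pderiv coeff_sum sum.delta coeff_eq_0 simp del: of_nat_Suc
        intro: le_degree)
qed

text \<open>If one of the two degree bounds is not attained, both sides vanish.\<close>

lemma coeff_mult_sum_bounds:
  fixes p q :: "'a::idom poly"
  assumes "degree p \<le> m" "degree q \<le> n"
  shows "coeff (p * q) (m + n) = coeff p m * coeff q n"
proof (cases "degree p = m \<and> degree q = n")
  case True
  then show ?thesis using coeff_mult_degree_sum[of p q] by auto
next
  case False
  then have "degree p < m \<or> degree q < n" using assms by auto
  moreover have "degree (p * q) < m + n"
    using degree_mult_le[of p q] assms calculation by linarith
  ultimately show ?thesis by (auto simp: coeff_eq_0)
qed

section \<open>Elementary symmetric functions and the Burgers equation\<close>

text \<open>The coefficients of \<open>\<Prod>\<^sub>j (1 - u\<^sub>j X)\<close> are, up to sign, the elementary symmetric functions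
  of the \<open>u\<^sub>j\<close>.\<close>

definition esym :: "'j set \<Rightarrow> ('j \<Rightarrow> complex) \<Rightarrow> nat \<Rightarrow> complex"
  where "esym A u N = coeff (\<Prod>j\<in>A. [:1, - u j:]) N"

lemma esym_empty: "esym {} u N = (if N = 0 then 1 else 0)"
  by (simp add: esym_def)

lemma esym_insert:
  assumes "finite A" "j \<notin> A"
  shows "esym (insert j A) u 0 = esym A u 0"
    and "esym (insert j A) u (Suc N) = esym A u (Suc N) - u j * esym A u N"
  using assms by (simp_all add: esym_def)

lemma esym_0: "finite A \<Longrightarrow> esym A u 0 = 1"
  by (induction A rule: finite_induct) (auto simp: esym_empty esym_insert)

lemma esym_eq_0:
  assumes "finite A" "card A < N"
  shows "esym A u N = 0"
proof -
  have "degree (\<Prod>j\<in>A. [:1, - u j:]) \<le> (\<Sum>j\<in>A. degree [:1, - u j:])"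
    by (rule degree_prod_sum_le[unfolded o_def]) (rule assms)
  also have "\<dots> \<le> (\<Sum>j\<in>A. 1)" by (intro sum_mono) simp
  finally show ?thesis using assms by (simp add: esym_def coeff_eq_0)
qed

text \<open>Vieta's formula, with the signs absorbed in \<open>esym\<close>.\<close>

lemma prod_diff_esym:
  assumes "finite A"
  shows "(\<Prod>j\<in>A. s - u j) = (\<Sum>N\<le>card A. esym A u N * s ^ (card A - N))"
  using assms
proof (induction A rule: finite_induct)
  case empty
  then show ?case by (simp add: esym_empty)
next
  case (insert j A)
  let ?d = "card A"
  \<comment> \<open>The shifted sum may run up to index \<open>card A + 1\<close>, because
    \<open>esym\<close> vanishes there.\<close>
  have 1: "(\<Sum>N\<le>?d. esym A u (Suc N) * s ^ (?d - N)) + s ^ Suc ?d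
      = s * (\<Sum>N\<le>?d. esym A u N * s ^ (?d - N))"
  proof -
    have "(\<Sum>N\<le>?d. esym A u (Suc N) * s ^ (?d - N)) + s ^ Suc ?d
        = (\<Sum>N\<le>Suc ?d. esym A u N * s ^ (Suc ?d - N))"
      by (subst sum.atMost_Suc_shift) (simp add: esym_0 insert)
    also have "\<dots> = (\<Sum>N\<le>?d. esym A u N * s ^ (Suc ?d - N))"
      using insert(1) by (simp add: esym_eq_0)
    also have "\<dots> = s * (\<Sum>N\<le>?d. esym A u N * s ^ (?d - N))"
      unfolding sum_distrib_left by (intro sum.cong) (auto simp: Suc_diff_le)
    finally show ?thesis .
  qed
  have "(\<Sum>N\<le>card (insert j A). esym (insert j A) u N * s ^ (card (insert j A) - N))
      = s ^ Suc ?d + (\<Sum>N\<le>?d. (esym A u (Suc N) - u j * esym A u N) * s ^ (?d - N))"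
    using insert(1,2) by (simp add: sum.atMost_Suc_shift esym_0 esym_insert del: sum.atMost_Suc)
  also have "\<dots> = (\<Sum>N\<le>?d. esym A u (Suc N) * s ^ (?d - N)) + s ^ Suc ?d
      - u j * (\<Sum>N\<le>?d. esym A u N * s ^ (?d - N))"
    by (simp only: left_diff_distrib sum_subtractf sum_distrib_left mult.assoc) simp
  also have "\<dots> = (s - u j) * (\<Sum>N\<le>?d. esym A u N * s ^ (?d - N))"
    unfolding 1 by (rule left_diff_distrib[symmetric])
  finally show ?case using insert by simp
qed

text \<open>\<open>f j\<close> and \<open>g j\<close> are the restrictions of a function to the w-
  and z-direction. For the product F(X) of the factors 1 - u_j X, the identity u X / (1 - u X) = 1 /
  (1 - u X) - 1 gives X F_w = F_z + (sum of the v_j) X F, and the claim compares coefficients. The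
  proof reaches it by adding one factor at a time.\<close>

lemma esym_transport:
  assumes "finite A"
    and "\<And>j. j \<in> A \<Longrightarrow> (f j has_field_derivative u j * v j) (at w)"
    and "\<And>j. j \<in> A \<Longrightarrow> (g j has_field_derivative v j) (at z)"
    and "\<And>j. j \<in> A \<Longrightarrow> f j w = u j" "\<And>j. j \<in> A \<Longrightarrow> g j z = u j"
  shows "\<exists>b. \<forall>N. ((\<lambda>t. esym A (\<lambda>j. g j t) N) has_field_derivative b N) (at z) \<and>
    ((\<lambda>t. esym A (\<lambda>j. f j t) N) has_field_derivative b (Suc N) + (\<Sum>j\<in>A. v j) * esym A u N) (at w)"
  using assms
proof (induction A rule: finite_induct)
  case empty
  then show ?case by (intro exI[of _ "\<lambda>_. 0"]) (simp add: esym_empty)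
next
  case (insert j A)
  obtain b where bz: "\<And>N. ((\<lambda>t. esym A (\<lambda>j. g j t) N) has_field_derivative b N) (at z)"
    and bw: "\<And>N. ((\<lambda>t. esym A (\<lambda>j. f j t) N) has_field_derivative
        b (Suc N) + (\<Sum>j\<in>A. v j) * esym A u N) (at w)"
  proof -
    have "\<exists>b. \<forall>N. ((\<lambda>t. esym A (\<lambda>j. g j t) N) has_field_derivative b N) (at z) \<and>
      ((\<lambda>t. esym A (\<lambda>j. f j t) N) has_field_derivative b (Suc N) + (\<Sum>j\<in>A. v j) * esym A u N) (at w)"
      by (rule insert.IH) (simp_all add: insert.prems)
    then show ?thesis using that by blast
  qed
  have cong: "esym A (\<lambda>j. f j w) N = esym A u N" "esym A (\<lambda>j. g j z) N = esym A u N" for N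
    unfolding esym_def using insert.prems(3,4)
    by (auto intro!: arg_cong[of _ _ "\<lambda>p. coeff p N"] prod.cong)
  have dj: "(f j has_field_derivative u j * v j) (at w)" "(g j has_field_derivative v j) (at z)"
    "f j w = u j" "g j z = u j" using insert.prems by auto
  have b0: "b 0 = 0"
    using DERIV_unique[OF bz[of 0], of 0] insert(1) by (simp add: esym_0)
  \<comment> \<open>The recursion of \<open>esym_insert\<close>, differentiated in z.\<close>
  define b' where "b' N = (case N of 0 \<Rightarrow> 0 | Suc k \<Rightarrow> b (Suc k) - v j * esym A u k - u j * b k)" for N
  have z: "((\<lambda>t. esym (insert j A) (\<lambda>j. g j t) N) has_field_derivative b' N) (at z)" for N
  proof (cases N)
    case 0
    then show ?thesis using insert(1,2) by (simp add: esym_0 b'_def)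
  next
    case (Suc k)
    have "((\<lambda>t. esym A (\<lambda>j. g j t) (Suc k) - g j t * esym A (\<lambda>j. g j t) k) has_field_derivative
        b (Suc k) - (v j * esym A (\<lambda>j. g j z) k + b k * g j z)) (at z)"
      by (intro DERIV_diff DERIV_mult bz dj)
    then show ?thesis
      using Suc insert(1,2) by (simp add: esym_insert b'_def cong dj algebra_simps)
  qed
  have w: "((\<lambda>t. esym (insert j A) (\<lambda>j. f j t) N) has_field_derivative
      b' (Suc N) + (\<Sum>j\<in>insert j A. v j) * esym (insert j A) u N) (at w)" for N
  proof (cases N)
    case 0
    then show ?thesis using insert(1,2) b0 by (simp add: esym_0 b'_def)
      (use bw[of 0] insert(1) in \<open>simp add: esym_0\<close>)
  next
    case (Suc k)
    let ?V = "\<Sum>j\<in>A. v j"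
    have "((\<lambda>t. esym A (\<lambda>j. f j t) (Suc k) - f j t * esym A (\<lambda>j. f j t) k) has_field_derivative
        (b (Suc (Suc k)) + ?V * esym A u (Suc k))
        - (u j * v j * esym A (\<lambda>j. f j w) k + (b (Suc k) + ?V * esym A u k) * f j w)) (at w)"
      by (intro DERIV_diff DERIV_mult bw dj)
    then show ?thesis
      using Suc insert(1,2) by (simp add: esym_insert b'_def cong dj algebra_simps)
  qed
  show ?case using z w by blast
qed

section \<open>Degree bounds for symmetric functions of Burgers solutions\<close>

lemma infinite_ball_complex: "r > 0 \<Longrightarrow> infinite (ball (a::complex) r)"
  using uncountable_ball uncountable_infinite by blast

text \<open>Since \<open>pderiv Q = q\<close> is retained, the top coefficient of \<open>Q\<close>
  can be read off from that of \<open>q\<close>.\<close>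

lemma pol_on_antiderivative:
  fixes f :: "complex \<Rightarrow> complex" and q :: "complex poly"
  assumes "r > 0" "degree q \<le> M"
    and "\<And>z. z \<in> ball 0 r \<Longrightarrow> (f has_field_derivative poly q z) (at z)"
  obtains Q where "degree Q \<le> Suc M" "\<And>z. z \<in> ball 0 r \<Longrightarrow> f z = poly Q z" "pderiv Q = q"
proof -
  obtain R where R: "pderiv R = q" by (rule poly_antiderivative[of q])
  have "((\<lambda>z. f z - poly R z) has_field_derivative 0) (at z within ball 0 r)" if "z \<in> ball 0 r" for z
  proof -
    have "((\<lambda>z. f z - poly R z) has_field_derivative poly q z - poly (pderiv R) z) (at z)"
      by (intro DERIV_diff assms(3) that poly_DERIV)
    then show ?thesis by (simp add: R has_field_derivative_at_within)
  qed
  then have "\<exists>c. \<forall>z\<in>ball 0 r. f z - poly R z = c"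
    by (intro has_field_derivative_zero_constant convex_ball)
  then obtain c where c: "\<And>z. z \<in> ball 0 r \<Longrightarrow> f z - poly R z = c" by blast
  let ?Q = "R + [:c:]"
  have pd: "pderiv ?Q = q" using R by (simp add: pderiv_add pderiv_pCons)
  show thesis
  proof
    have "degree q = degree ?Q - 1" using degree_pderiv[of ?Q] unfolding pd .
    then show "degree ?Q \<le> Suc M" using assms(2) by linarith
    show "f z = poly ?Q z" if "z \<in> ball 0 r" for z using c[OF that] by (simp add: algebra_simps)
  qed (rule pd)
qed

text \<open>\<open>v j\<close> is the z-derivative of \<open>u j\<close>, so that \<open>dw\<close>
  is the Burgers equation. Derivatives are taken in each variable separately, with z in a fixed disc
  and w in an open set.\<close>

locale burgers =
  fixes A :: "'j set" and u v :: "'j \<Rightarrow> complex \<Rightarrow> complex \<Rightarrow> complex"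
    and W :: "complex set" and r :: real
  assumes fin: "finite A" and W: "open W" and r: "r > 0"
    and dw: "\<And>j w z. j \<in> A \<Longrightarrow> w \<in> W \<Longrightarrow> z \<in> ball 0 r \<Longrightarrow>
      ((\<lambda>w. u j w z) has_field_derivative u j w z * v j w z) (at w)"
    and dz: "\<And>j w z. j \<in> A \<Longrightarrow> w \<in> W \<Longrightarrow> z \<in> ball 0 r \<Longrightarrow>
      ((\<lambda>z. u j w z) has_field_derivative v j w z) (at z)"
begin

abbreviation a where "a N w z \<equiv> esym A (\<lambda>j. u j w z) N"

text \<open>In \<open>\<partial>\<^sub>z a\<^bsub>N+1\<^esub> = \<partial>\<^sub>w a\<^sub>N - (\<Sum>\<^sub>j \<partial>\<^sub>z u\<^sub>j) a\<^sub>N\<close> the last term has the largest degree as soon as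
  \<open>E \<ge> 2\<close>, so the top coefficients can be integrated explicitly.\<close>

lemma esym_top_coeff:
  assumes E: "E \<ge> 1" and deg: "\<And>w. w \<in> W \<Longrightarrow> degree (P w) \<le> E"
    and P: "\<And>w z. w \<in> W \<Longrightarrow> z \<in> ball 0 r \<Longrightarrow> (\<Sum>j\<in>A. u j w z) = poly (P w) z"
    and w: "w \<in> W"
  shows "\<exists>q. degree q \<le> N * E \<and> (\<forall>z\<in>ball 0 r. a N w z = poly q z) \<and>
    (E \<ge> 2 \<longrightarrow> coeff q (N * E) = (- coeff (P w) E) ^ N / fact N)"
  using w
proof (induction N arbitrary: w)
  case 0
  show ?case by (intro exI[of _ 1]) (simp add: esym_0 fin)
next
  case (Suc N)
  note w = \<open>w \<in> W\<close>
  have "\<forall>z\<in>ball 0 r. \<exists>b. \<forall>N. ((\<lambda>t. a N w t) has_field_derivative b N) (at z) \<and>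
    ((\<lambda>t. a N t z) has_field_derivative b (Suc N) + (\<Sum>j\<in>A. v j w z) * a N w z) (at w)"
    by (intro ballI esym_transport fin dw dz w) auto
  then obtain b where bz: "\<And>z N. z \<in> ball 0 r \<Longrightarrow> ((\<lambda>t. a N w t) has_field_derivative b z N) (at z)"
    and bw: "\<And>z N. z \<in> ball 0 r \<Longrightarrow>
      ((\<lambda>t. a N t z) has_field_derivative b z (Suc N) + (\<Sum>j\<in>A. v j w z) * a N w z) (at w)"
    by metis
  obtain q where q: "degree q \<le> N * E" "\<And>z. z \<in> ball 0 r \<Longrightarrow> a N w z = poly q z"
    "E \<ge> 2 \<Longrightarrow> coeff q (N * E) = (- coeff (P w) E) ^ N / fact N"
    using Suc.IH[OF w] by blast
  have V: "(\<Sum>j\<in>A. v j w z) = poly (pderiv (P w)) z" if z: "z \<in> ball 0 r" for z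
  proof (rule DERIV_unique)
    show "((\<lambda>z. \<Sum>j\<in>A. u j w z) has_field_derivative (\<Sum>j\<in>A. v j w z)) (at z)"
      by (intro DERIV_sum dz w z)
    have "(poly (P w) has_field_derivative poly (pderiv (P w)) z) (at z)" by (rule poly_DERIV)
    then show "((\<lambda>z. \<Sum>j\<in>A. u j w z) has_field_derivative poly (pderiv (P w)) z) (at z)"
      by (rule has_field_derivative_transform_within_open[OF _ open_ball z]) (simp add: P w)
  qed
  obtain e where e: "e > 0" "ball w e \<subseteq> W" using W w openE by blast
  \<comment> \<open>A sequence tending to \<open>w\<close>, along which difference quotients will be
    taken. The denominator \<open>n + 2\<close> keeps it strictly inside the ball of radius
    \<open>e\<close>.\<close>
  define wn where "wn n = w + of_real (e / real (Suc (Suc n)))" for n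
  have wn: "wn n \<in> W" for n
  proof -
    have "dist w (wn n) = e / real (Suc (Suc n))"
      unfolding wn_def dist_norm using e(1) by (simp del: of_real_divide of_nat_Suc)
    also have "\<dots> < e" using e(1) by (simp add: field_simps add_pos_nonneg)
    finally show ?thesis using e(2) by auto
  qed
  have wn_ne: "wn n \<noteq> w" for n using e(1) by (simp add: wn_def del: of_nat_Suc)
  have "(\<lambda>n. e / real (Suc (Suc n))) \<longlonglongrightarrow> 0"
    using LIMSEQ_Suc[OF LIMSEQ_Suc[OF lim_const_over_n[of e]]] .
  then have "wn \<longlonglongrightarrow> w + of_real 0" unfolding wn_def by (intro tendsto_intros)
  then have wn_lim: "filterlim wn (at w) sequentially"
    using wn_ne by (simp add: filterlim_at)
  \<comment> \<open>For fixed \<open>w\<close> the w-derivative of a_N is a pointwise limit in z of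
    difference quotients, all polynomial of degree at most \<open>N * E\<close>. So it is such a
    polynomial itself, and the dependence of the coefficients on w never enters.\<close>
  have "pol_on (ball 0 r) (N * E) (\<lambda>z. b z (Suc N) + (\<Sum>j\<in>A. v j w z) * a N w z)"
  proof (rule pol_on_limit)
    show "infinite (ball (0::complex) r)" by (rule infinite_ball_complex[OF r])
    have pol: "pol_on (ball 0 r) (N * E) (a N w')" if "w' \<in> W" for w'
      using Suc.IH[OF that] unfolding pol_on_def by blast
    show "pol_on (ball 0 r) (N * E) (\<lambda>z. 1 / (wn n - w) * (a N (wn n) z + - 1 * a N w z))" for n
      by (intro pol_on_add pol_on_cmult pol wn w)
    fix z :: complex assume "z \<in> ball 0 r"
    from bw[OF this, of N]
    have "((\<lambda>t. (a N t z - a N w z) / (t - w)) \<longlongrightarrow> b z (Suc N) + (\<Sum>j\<in>A. v j w z) * a N w z) (at w)"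
      by (simp add: has_field_derivative_iff)
    from filterlim_compose[OF this wn_lim]
    show "(\<lambda>n. 1 / (wn n - w) * (a N (wn n) z + - 1 * a N w z)) \<longlonglongrightarrow>
        b z (Suc N) + (\<Sum>j\<in>A. v j w z) * a N w z"
      by simp
  qed
  then obtain R where R: "degree R \<le> N * E"
    "\<And>z. z \<in> ball 0 r \<Longrightarrow> b z (Suc N) + (\<Sum>j\<in>A. v j w z) * a N w z = poly R z"
    unfolding pol_on_def by blast
  have dP: "degree (pderiv (P w)) \<le> E - 1" using degree_pderiv[of "P w"] deg[OF w] by simp
  \<comment> \<open>This will be the z-derivative of a_(N+1): the w-derivative \<open>R\<close> of
    a_N minus the z-derivative of the trace times a_N.\<close>
  let ?q' = "R - pderiv (P w) * q"
  have "degree (pderiv (P w) * q) \<le> E - 1 + N * E"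
    using degree_mult_le dP q(1) by (meson add_mono le_trans)
  then have dq': "degree ?q' \<le> E - 1 + N * E"
    using R(1) by (intro degree_diff_le) auto
  have "((\<lambda>t. a (Suc N) w t) has_field_derivative poly ?q' z) (at z)" if "z \<in> ball 0 r" for z
  proof -
    have "b z (Suc N) = poly ?q' z"
      using R(2)[OF that] V[OF that] q(2)[OF that] by (simp add: eq_diff_eq)
    then show ?thesis using bz[OF that, of "Suc N"] by simp
  qed
  from pol_on_antiderivative[OF r dq' this]
  obtain Q where Q: "degree Q \<le> Suc (E - 1 + N * E)"
    "\<And>z. z \<in> ball 0 r \<Longrightarrow> a (Suc N) w z = poly Q z" "pderiv Q = ?q'" by blast
  have eq: "Suc (E - 1 + N * E) = Suc N * E" using E by simp
  have "coeff Q (Suc N * E) = (- coeff (P w) E) ^ Suc N / fact (Suc N)" if "E \<ge> 2"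
  proof -
    let ?s = "coeff (P w) E"
    have "of_nat (Suc (E - 1 + N * E)) * coeff Q (Suc (E - 1 + N * E)) = coeff ?q' (E - 1 + N * E)"
      using Q(3) coeff_pderiv by metis
    \<comment> \<open>Here \<open>E \<ge> 2\<close> enters: \<open>R\<close> has degree at most
      \<open>N * E\<close>, which is less than \<open>E - 1 + N * E\<close>, so it does not reach
      the top coefficient.\<close>
    also have "\<dots> = - (coeff (pderiv (P w)) (E - 1) * coeff q (N * E))"
      using coeff_mult_sum_bounds[OF dP q(1)] R(1) that by (simp add: coeff_eq_0)
    also have "\<dots> = - (of_nat E * ?s * ((- ?s) ^ N / fact N))"
      using that E by (simp add: coeff_pderiv q(3) del: of_nat_Suc)
    finally have "of_nat E * (of_nat (Suc N) * coeff Q (Suc N * E)) =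
        of_nat E * ((- ?s) ^ Suc N / fact N)"
      unfolding eq by (simp add: algebra_simps)
    moreover have "(of_nat E :: complex) \<noteq> 0" using E by simp
    ultimately have "of_nat (Suc N) * coeff Q (Suc N * E) = (- ?s) ^ Suc N / fact N"
      using mult_left_cancel by blast
    then have "coeff Q (Suc N * E) = ((- ?s) ^ Suc N / fact N) / of_nat (Suc N)"
      by (metis nonzero_mult_div_cancel_left of_nat_eq_0_iff nat.distinct(2))
    then show ?thesis by (simp add: field_simps)
  qed
  then show ?case using Q eq by metis
qed

text \<open>Since \<open>a\<^sub>N\<close> vanishes for \<open>N = |A| + 1\<close>, so does its top coefficient.\<close>

lemma trace_degree_le_1:
  assumes "\<And>w. w \<in> W \<Longrightarrow> pol_on (ball 0 r) M (\<lambda>z. \<Sum>j\<in>A. u j w z)"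
  shows "\<forall>w\<in>W. pol_on (ball 0 r) 1 (\<lambda>z. \<Sum>j\<in>A. u j w z)"
  using assms
proof (induction M)
  case 0
  then show ?case using pol_on_mono by blast
next
  case (Suc M)
  show ?case
  proof (cases "M = 0")
    case True
    then show ?thesis using Suc.prems by simp
  next
    case False
    obtain P where P: "\<And>w. w \<in> W \<Longrightarrow> degree (P w) \<le> Suc M"
      "\<And>w z. w \<in> W \<Longrightarrow> z \<in> ball 0 r \<Longrightarrow> (\<Sum>j\<in>A. u j w z) = poly (P w) z"
      using Suc.prems unfolding pol_on_def by metis
    show ?thesis
    \<comment> \<open>For E = M + 1 \<ge> 2 the top coefficient of the trace is shown to vanish. The
      same \<open>P\<close> then has degree at most \<open>M\<close>, and the induction goes
      on.\<close>
    proof (rule Suc.IH, rule pol_onI)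
      fix w assume w: "w \<in> W"
      let ?N = "Suc (card A)"
      obtain q where q: "\<forall>z\<in>ball 0 r. a ?N w z = poly q z"
        "coeff q (?N * Suc M) = (- coeff (P w) (Suc M)) ^ ?N / fact ?N"
        using esym_top_coeff[OF _ P w, of ?N] False by auto
      have "q = 0"
      proof (rule poly_eq_on_infinite[OF infinite_ball_complex[OF r]])
        show "poly q z = poly 0 z" if "z \<in> ball 0 r" for z
          using q(1) that by (simp add: esym_eq_0 fin)
      qed
      then have "(- coeff (P w) (Suc M)) ^ ?N / fact ?N = 0" using q(2) by simp
      then have "(- coeff (P w) (Suc M)) ^ ?N = 0" by (simp del: power_Suc fact_Suc)
      then have "coeff (P w) (Suc M) = 0" by (metis neg_equal_0_iff_equal power_not_zero)
      then show "degree (P w) \<le> M"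
        using P(1)[OF w] by (metis eq_zero_or_degree_less degree_0 le_eq_less_or_eq less_Suc_eq_le leading_coeff_0_iff zero_le)
    qed (rule P(2))
  qed
qed

text \<open>Once the trace is affine, \<open>esym_top_coeff\<close> applies with
  \<open>E = 1\<close>. The bound \<open>N\<close> no longer involves \<open>M\<close>, so the
  defining polynomials will have degree at most \<open>d\<close> rather than
  \<open>d + D\<close>.\<close>

theorem esym_degree_le:
  assumes "\<And>w. w \<in> W \<Longrightarrow> pol_on (ball 0 r) M (\<lambda>z. \<Sum>j\<in>A. u j w z)" and "w \<in> W"
  shows "pol_on (ball 0 r) N (\<lambda>z. a N w z)"
proof -
  obtain P where "\<And>w. w \<in> W \<Longrightarrow> degree (P w) \<le> 1"
    "\<And>w z. w \<in> W \<Longrightarrow> z \<in> ball 0 r \<Longrightarrow> (\<Sum>j\<in>A. u j w z) = poly (P w) z"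
    using trace_degree_le_1[OF assms(1)] unfolding pol_on_def by metis
  from esym_top_coeff[OF _ this assms(2), of N] show ?thesis unfolding pol_on_def by auto
qed

end

section \<open>Polynomials in several variables\<close>

text \<open>Exponents are plain functions here; \<open>cpoly_of_coeffs\<close> converts them to
  finitely supported maps.\<close>

definition exps :: "nat \<Rightarrow> ('i::finite \<Rightarrow> nat) set"
  where "exps N = {k. (\<Sum>i\<in>UNIV. k i) \<le> N}"

definition mono_eval :: "complex ^ 'i::finite \<Rightarrow> ('i \<Rightarrow> nat) \<Rightarrow> complex"
  where "mono_eval \<zeta> k = (\<Prod>i\<in>UNIV. (\<zeta> $ i) ^ k i)"

lemma exps_subset: "exps N \<subseteq> PiE UNIV (\<lambda>_. {..N})"
proof
  fix k :: "'a \<Rightarrow> nat" assume "k \<in> exps N"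
  then have "k i \<le> N" for i
    using member_le_sum[of i UNIV k] by (auto simp: exps_def)
  then show "k \<in> PiE UNIV (\<lambda>_. {..N})" by auto
qed

lemma finite_exps: "finite (exps N)"
  by (rule finite_subset[OF exps_subset]) (auto intro: finite_PiE)

lemma mono_eval_scale: "mono_eval (z *s \<zeta>) k = mono_eval \<zeta> k * z ^ (\<Sum>i\<in>UNIV. k i)"
  by (simp add: mono_eval_def power_mult_distrib prod.distrib power_sum mult.commute)

section \<open>Functions that are polynomial along complex lines\<close>

lemma pol_on_scale:
  assumes "pol_on (cball 0 1) N (\<lambda>z. f (z * of_real \<rho>))" "\<rho> > 0"
  shows "pol_on (ball 0 \<rho>) N f"
proof -
  obtain p where p: "degree p \<le> N" "\<And>z. norm z \<le> 1 \<Longrightarrow> f (z * of_real \<rho>) = poly p z"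
    using assms(1) unfolding pol_on_def by auto
  show ?thesis
  proof (rule pol_onI)
    show "degree (pcompose p [:0, 1 / of_real \<rho>:]) \<le> N"
      using p(1) assms(2) by (simp add: degree_pcompose)
    fix z :: complex assume "z \<in> ball 0 \<rho>"
    then have "norm (z / of_real \<rho>) \<le> 1" using assms(2) by (simp add: norm_divide)
    from p(2)[OF this] show "f z = poly (pcompose p [:0, 1 / of_real \<rho>:]) z"
      using assms(2) by (simp add: poly_pcompose)
  qed
qed

text \<open>The degree is tested on discs whose centre and direction both have norm below
  \<open>R\<close>; their points may have norm up to \<open>2 * R\<close>.\<close>

definition line_pol :: "real \<Rightarrow> nat \<Rightarrow> (complex ^ 'i::finite \<Rightarrow> complex) \<Rightarrow> bool"
  where "line_pol R N f \<longleftrightarrow>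
    (\<forall>a b. norm a < R \<longrightarrow> norm b < R \<longrightarrow> pol_on (cball 0 1) N (\<lambda>z. f (a + z *s b)))"

lemma norm_axis: "norm (axis i c :: 'a::real_normed_vector ^ 'i::finite) = norm c"
proof -
  have "(\<Sum>j\<in>UNIV. (norm ((axis i c :: 'a ^ 'i) $ j))\<^sup>2) = (\<Sum>j\<in>UNIV. if j = i then (norm c)\<^sup>2 else 0)"
    by (intro sum.cong) (auto simp: axis_def)
  then show ?thesis by (simp add: norm_vec_def L2_set_def)
qed

lemma poly_eq_sum_atMost:
  fixes p :: "'a::comm_semiring_1 poly"
  shows "degree p \<le> N \<Longrightarrow> poly p x = (\<Sum>k\<le>N. coeff p k * x ^ k)"
  unfolding poly_altdef by (intro sum.mono_neutral_left) (auto simp: coeff_eq_0)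

lemma norm_le_sum_components: "norm (x :: 'a::real_normed_vector ^ 'i::finite) \<le> (\<Sum>i\<in>UNIV. norm (x $ i))"
  unfolding norm_vec_def by (intro L2_set_le_sum) auto

lemma norm_cube_less:
  fixes \<zeta> :: "complex ^ 'i::finite"
  assumes "\<And>i. norm (\<zeta> $ i) < R / real CARD('i)"
  shows "norm \<zeta> < R"
proof -
  have "norm \<zeta> \<le> (\<Sum>i\<in>UNIV. norm (\<zeta> $ i))" by (rule norm_le_sum_components)
  also have "\<dots> < (\<Sum>i\<in>(UNIV::'i set). R / real CARD('i))"
    by (intro sum_strict_mono assms) auto
  finally show ?thesis by simp
qed

text \<open>One-variable interpolation is applied to the coordinates in \<open>I\<close> one after
  another, the others staying at those of \<zeta>. The choice \<open>I = UNIV\<close> yields the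
  tensor product formula.\<close>

lemma grid_interpolation:
  fixes f :: "complex ^ 'i::finite \<Rightarrow> complex"
  assumes coord: "\<And>\<zeta> i. (\<And>i. \<zeta> $ i \<in> A) \<Longrightarrow> pol_on A N (\<lambda>z. f (\<chi> i'. if i' = i then z else \<zeta> $ i'))"
    and c: "\<And>j. c j \<in> A"
    and repr: "\<And>f z. pol_on A N f \<Longrightarrow> z \<in> A \<Longrightarrow> f z = (\<Sum>j\<le>N. f (c j) * poly (l j) z)"
    and \<zeta>: "\<And>i. \<zeta> $ i \<in> A" and "finite I"
  shows "f \<zeta> = (\<Sum>g\<in>PiE I (\<lambda>_. {..N}).
    f (\<chi> i. if i \<in> I then c (g i) else \<zeta> $ i) * (\<Prod>i\<in>I. poly (l (g i)) (\<zeta> $ i)))"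
  using \<open>finite I\<close>
proof (induction I rule: finite_induct)
  case empty
  then show ?case by simp
next
  case (insert i I)
  let ?x = "\<lambda>g. (\<chi> i. if i \<in> I then c (g i) else \<zeta> $ i)"
  let ?y = "\<lambda>g. (\<chi> i'. if i' \<in> insert i I then c (g i') else \<zeta> $ i')"
  let ?T = "\<lambda>I g. (\<Prod>i\<in>I. poly (l (g i)) (\<zeta> $ i))"
  have step: "f (?x g) = (\<Sum>j\<le>N. f (?y (g(i := j))) * poly (l j) (\<zeta> $ i))" for g
  proof -
    have 1: "?x g $ i' \<in> A" for i' using c \<zeta> by simp
    have "f (\<chi> i'. if i' = i then \<zeta> $ i else ?x g $ i') =
      (\<Sum>j\<le>N. f (\<chi> i'. if i' = i then c j else ?x g $ i') * poly (l j) (\<zeta> $ i))"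
      by (rule repr[OF coord[OF 1] \<zeta>])
    moreover have "(\<chi> i'. if i' = i then \<zeta> $ i else ?x g $ i') = ?x g"
      using insert(2) by (auto simp: vec_eq_iff)
    moreover have "(\<chi> i'. if i' = i then c j else ?x g $ i') = ?y (g(i := j))" for j
      using insert(2) by (auto simp: vec_eq_iff)
    ultimately show ?thesis by simp
  qed
  \<comment> \<open>A choice of nodes on \<open>insert i I\<close> is a node index for
    \<open>i\<close> together with a choice on \<open>I\<close>; the sum over the former is
    evaluated by \<open>step\<close>.\<close>
  have "(\<Sum>g\<in>PiE (insert i I) (\<lambda>_. {..N}). f (?y g) * ?T (insert i I) g)
      = (\<Sum>(j, g)\<in>{..N} \<times> PiE I (\<lambda>_. {..N}). f (?y (g(i := j))) * ?T (insert i I) (g(i := j)))"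
    unfolding PiE_insert_eq
    by (subst sum.reindex[OF inj_combinator[OF insert(2)]]) (simp add: case_prod_unfold)
  also have "\<dots> = (\<Sum>(j, g)\<in>{..N} \<times> PiE I (\<lambda>_. {..N}).
      f (?y (g(i := j))) * poly (l j) (\<zeta> $ i) * ?T I g)"
  proof (intro sum.cong refl, clarify)
    fix j g
    have "?T I (g(i := j)) = ?T I g" using insert(2) by (intro prod.cong) auto
    then show "f (?y (g(i := j))) * ?T (insert i I) (g(i := j)) =
        f (?y (g(i := j))) * poly (l j) (\<zeta> $ i) * ?T I g"
      using insert(1,2) by simp
  qed
  also have "\<dots> = (\<Sum>j\<le>N. \<Sum>g\<in>PiE I (\<lambda>_. {..N}). f (?y (g(i := j))) * poly (l j) (\<zeta> $ i) * ?T I g)"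
    by (rule sum.cartesian_product[symmetric])
  also have "\<dots> = (\<Sum>g\<in>PiE I (\<lambda>_. {..N}). \<Sum>j\<le>N. f (?y (g(i := j))) * poly (l j) (\<zeta> $ i) * ?T I g)"
    by (rule sum.swap)
  also have "\<dots> = (\<Sum>g\<in>PiE I (\<lambda>_. {..N}). f (?x g) * ?T I g)"
    by (simp only: step sum_distrib_right)
  also have "\<dots> = f \<zeta>" by (rule insert.IH[symmetric])
  finally show ?case by simp
qed

text \<open>\<open>\<rho>\<close> and \<open>W\<close> are chosen before \<open>f\<close>, which
  later gives uniformity over an infinite family. Grid interpolation bounds the degree in each
  variable by \<open>N\<close>; lines through the origin then cut the total degree down to
  \<open>N\<close>.\<close>

lemma multivariate_interpolation:
  fixes R :: real
  assumes "R > 0"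
  obtains \<rho> W :: real where "\<rho> > 0" "W \<ge> 0"
    "\<And>f :: complex ^ 'i::finite \<Rightarrow> complex. line_pol R N f \<Longrightarrow>
      \<exists>C. (\<forall>\<zeta>. norm \<zeta> < \<rho> \<longrightarrow> f \<zeta> = (\<Sum>k\<in>exps N. C k * mono_eval \<zeta> k)) \<and>
        (\<forall>B. (\<forall>\<zeta>. norm \<zeta> < R \<longrightarrow> norm (f \<zeta>) \<le> B) \<longrightarrow> (\<forall>k\<in>exps N. norm (C k) \<le> W * B))"
proof -
  \<comment> \<open>Points whose coordinates all have modulus below \<open>\<rho>\<close> then lie
    in the ball of radius \<open>R\<close>.\<close>
  define \<rho> where "\<rho> = R / (2 * real CARD('i))"
  have \<rho>: "\<rho> > 0" "\<rho> < R / real CARD('i)"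
    using assms by (auto simp: \<rho>_def field_simps)
  have "R / real CARD('i) \<le> R / 1" using assms by (intro divide_left_mono) (auto simp: Suc_leI)
  then have \<rho>R: "\<rho> < R" using \<rho>(2) by simp
  let ?A = "ball (0::complex) \<rho>"
  obtain c l where c: "\<And>j. c j \<in> ?A" and deg: "\<And>j. j \<le> N \<Longrightarrow> degree (l j) \<le> N"
    and repr: "\<And>f z. pol_on ?A N f \<Longrightarrow> z \<in> ?A \<Longrightarrow> f z = (\<Sum>j\<le>N. f (c j) * poly (l j) z)"
    using lagrange_interpolation[OF infinite_ball_complex[OF \<rho>(1)], where M = N] by metis
  let ?K = "PiE (UNIV :: 'i set) (\<lambda>_. {..N})"
  have finK: "finite ?K" by (intro finite_PiE) auto
  define D where "D g k = (\<Prod>i\<in>UNIV. coeff (l (g i)) (k i))" for g k :: "'i \<Rightarrow> nat"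
  define W where "W = (\<Sum>g\<in>?K. \<Sum>k\<in>?K. norm (D g k))"
  have cube: "norm \<zeta> < R" if "\<And>i. \<zeta> $ i \<in> ?A" for \<zeta> :: "complex ^ 'i"
    using that \<rho>(2) by (intro norm_cube_less) (auto intro: less_trans)
  show thesis
  proof (rule that[of \<rho> W])
    show "\<rho> > 0" by fact
    show "W \<ge> 0" unfolding W_def by (intro sum_nonneg) auto
    fix f :: "complex ^ 'i \<Rightarrow> complex" assume f: "line_pol R N f"
    define C where "C k = (\<Sum>g\<in>?K. f (\<chi> i. c (g i)) * D g k)" for k
    have coord: "pol_on ?A N (\<lambda>z. f (\<chi> i'. if i' = i then z else \<zeta> $ i'))"
      if "\<And>i. \<zeta> $ i \<in> ?A" for \<zeta> i
    proof (rule pol_on_scale[OF _ \<rho>(1)])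
      let ?a = "\<chi> i'. if i' = i then 0 else \<zeta> $ i'"
      have "norm ?a < R" using that \<rho>(1) by (intro cube) (auto simp: )
      moreover have "norm (axis i (of_real \<rho>) :: complex ^ 'i) < R"
        using \<rho>(1) \<rho>R by (simp add: norm_axis)
      ultimately have "pol_on (cball 0 1) N (\<lambda>z. f (?a + z *s axis i (of_real \<rho>)))"
        using f unfolding line_pol_def by blast
      moreover have "(\<chi> i'. if i' = i then z * of_real \<rho> else \<zeta> $ i') = ?a + z *s axis i (of_real \<rho>)" for z
        by (auto simp: vec_eq_iff axis_def)
      ultimately show "pol_on (cball 0 1) N (\<lambda>z. f (\<chi> i'. if i' = i then z * of_real \<rho> else \<zeta> $ i'))"
        by simp
    qed
    have full: "f \<zeta> = (\<Sum>k\<in>?K. C k * mono_eval \<zeta> k)" if "\<And>i. \<zeta> $ i \<in> ?A" for \<zeta>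
    proof -
      have "f \<zeta> = (\<Sum>g\<in>?K. f (\<chi> i. c (g i)) * (\<Prod>i\<in>UNIV. poly (l (g i)) (\<zeta> $ i)))"
        using grid_interpolation[where I = UNIV, OF coord c repr that] by simp
      also have "\<dots> = (\<Sum>g\<in>?K. f (\<chi> i. c (g i)) * (\<Sum>k\<in>?K. D g k * mono_eval \<zeta> k))"
      proof (intro sum.cong refl arg_cong2[of _ _ _ _ "(*)"])
        fix g assume g: "g \<in> ?K"
        have "(\<Prod>i\<in>UNIV. poly (l (g i)) (\<zeta> $ i)) =
            (\<Prod>i\<in>UNIV. \<Sum>k\<le>N. coeff (l (g i)) k * (\<zeta> $ i) ^ k)"
          using g deg by (intro prod.cong refl poly_eq_sum_atMost) auto
        also have "\<dots> = (\<Sum>k\<in>?K. \<Prod>i\<in>UNIV. coeff (l (g i)) (k i) * (\<zeta> $ i) ^ k i)"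
          by (rule prod_sum_PiE) auto
        finally show "(\<Prod>i\<in>UNIV. poly (l (g i)) (\<zeta> $ i)) = (\<Sum>k\<in>?K. D g k * mono_eval \<zeta> k)"
          by (simp add: D_def mono_eval_def prod.distrib)
      qed
      also have "\<dots> = (\<Sum>k\<in>?K. C k * mono_eval \<zeta> k)"
        unfolding C_def sum_distrib_left sum_distrib_right mult.assoc by (rule sum.swap)
      finally show ?thesis .
    qed
    have "f \<zeta> = (\<Sum>k\<in>exps N. C k * mono_eval \<zeta> k)" if "norm \<zeta> < \<rho>" for \<zeta>
    proof -
      have A: "\<zeta> $ i \<in> ?A" for i
        using Finite_Cartesian_Product.norm_nth_le[of \<zeta> i] that by simp
      have "pol_on (cball 0 1) N (\<lambda>z. f (0 + z *s \<zeta>))"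
        using f assms that \<rho>R unfolding line_pol_def by (metis norm_zero order_less_trans)
      then obtain p where p: "degree p \<le> N" "\<And>z. norm z \<le> 1 \<Longrightarrow> f (z *s \<zeta>) = poly p z"
        unfolding pol_on_def by auto
      \<comment> \<open>Along the line through the origin and \<zeta>, the expansion becomes a
        polynomial in z whose coefficients are the homogeneous parts at \<zeta>. It equals
        \<open>p\<close>, so the parts of degree above \<open>N\<close> contribute nothing.\<close>
      define q where "q = (\<Sum>k\<in>?K. monom (C k * mono_eval \<zeta> k) (\<Sum>i\<in>UNIV. k i))"
      have "p = q"
      proof (rule poly_eq_on_infinite)
        show "infinite (ball (0::complex) 1)" by (rule infinite_ball_complex) simp
        fix z :: complex assume z: "z \<in> ball 0 1"
        have "(z *s \<zeta>) $ i \<in> ?A" for i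
        proof -
          have "norm z * norm (\<zeta> $ i) \<le> 1 * norm (\<zeta> $ i)"
            using z by (intro mult_right_mono) auto
          then show ?thesis using A[of i] by (simp add: norm_mult)
        qed
        from full[OF this] have "f (z *s \<zeta>) = poly q z"
          by (simp add: q_def poly_sum poly_monom mono_eval_scale mult.assoc)
        then show "poly p z = poly q z" using p(2)[of z] z by simp
      qed
      have "f \<zeta> = poly p 1" using p(2)[of 1] by simp
      also have "\<dots> = (\<Sum>n\<le>N. coeff p n)" using poly_eq_sum_atMost[OF p(1), of 1] by simp
      also have "\<dots> = (\<Sum>n\<le>N. \<Sum>k\<in>?K. if (\<Sum>i\<in>UNIV. k i) = n then C k * mono_eval \<zeta> k else 0)"
        unfolding \<open>p = q\<close> q_def by (simp add: coeff_sum)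
      also have "\<dots> = (\<Sum>k\<in>?K. \<Sum>n\<le>N. if (\<Sum>i\<in>UNIV. k i) = n then C k * mono_eval \<zeta> k else 0)"
        by (rule sum.swap)
      also have "\<dots> = (\<Sum>k\<in>?K. if k \<in> exps N then C k * mono_eval \<zeta> k else 0)"
        by (intro sum.cong refl) (simp add: sum.delta' exps_def)
      also have "\<dots> = (\<Sum>k\<in>exps N. C k * mono_eval \<zeta> k)"
        using finK exps_subset by (subst sum.inter_restrict[symmetric]) (auto intro!: sum.cong)
      finally show ?thesis .
    qed
    moreover have "norm (C k) \<le> W * B" if B: "\<And>\<zeta>. norm \<zeta> < R \<Longrightarrow> norm (f \<zeta>) \<le> B" and k: "k \<in> exps N" for B k
    proof -
      have "norm (C k) \<le> (\<Sum>g\<in>?K. norm (f (\<chi> i. c (g i))) * norm (D g k))"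
        unfolding C_def by (rule sum_norm_le) (simp add: norm_mult)
      also have "\<dots> \<le> (\<Sum>g\<in>?K. B * (\<Sum>k\<in>?K. norm (D g k)))"
      proof (intro sum_mono mult_mono)
        show 1: "norm (f (\<chi> i. c (g i))) \<le> B" for g
          by (intro B cube) (use c in auto)
        then show "B \<ge> 0" using norm_ge_zero order.trans by blast
        show "norm (D g k) \<le> (\<Sum>k\<in>?K. norm (D g k))" for g
          using k exps_subset finK by (intro member_le_sum) auto
      qed auto
      finally show ?thesis by (simp add: W_def sum_distrib_left mult.commute)
    qed
    ultimately show "\<exists>C. (\<forall>\<zeta>. norm \<zeta> < \<rho> \<longrightarrow> f \<zeta> = (\<Sum>k\<in>exps N. C k * mono_eval \<zeta> k)) \<and>
        (\<forall>B. (\<forall>\<zeta>. norm \<zeta> < R \<longrightarrow> norm (f \<zeta>) \<le> B) \<longrightarrow> (\<forall>k\<in>exps N. norm (C k) \<le> W * B))"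
      by blast
  qed
qed

section \<open>From coefficients to finite families of polynomials\<close>

lemma cpoly_of_coeffs:
  fixes C :: "('i::finite \<Rightarrow> nat) \<Rightarrow> complex"
  obtains P :: "'i cpoly" where "total_degree P \<le> N"
    "\<And>\<zeta>. poly_eval P \<zeta> = (\<Sum>k\<in>exps N. C k * mono_eval \<zeta> k)"
proof -
  let ?f = "\<lambda>e. if Poly_Mapping.lookup e \<in> exps N then C (Poly_Mapping.lookup e) else 0"
  define P :: "'i cpoly" where "P = Poly_Mapping.Abs_poly_mapping ?f"
  have inj: "inj (Poly_Mapping.lookup :: ('i \<Rightarrow>\<^sub>0 nat) \<Rightarrow> _)"
    by (simp add: inj_def Poly_Mapping.lookup_inject)
  \<comment> \<open>On a finite index type every exponent function is finitely supported.\<close>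
  have surj: "range (Poly_Mapping.lookup :: ('i \<Rightarrow>\<^sub>0 nat) \<Rightarrow> _) = UNIV"
  proof -
    have "Poly_Mapping.lookup (Poly_Mapping.Abs_poly_mapping k) = k" for k :: "'i \<Rightarrow> nat"
      by (rule Abs_poly_mapping_inverse) simp
    then show ?thesis by (metis surjI)
  qed
  let ?E = "(Poly_Mapping.lookup :: ('i \<Rightarrow>\<^sub>0 nat) \<Rightarrow> _) -` exps N"
  have finE: "finite ?E" by (rule finite_vimageI[OF finite_exps inj])
  have img: "Poly_Mapping.lookup ` ?E = exps N" unfolding image_vimage_eq surj by simp
  have lookup: "Poly_Mapping.lookup P = ?f"
    unfolding P_def by (rule Abs_poly_mapping_inverse) (rule CollectI, rule finite_subset[OF _ finE], auto split: if_splits)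
  have keys: "Poly_Mapping.keys P \<subseteq> ?E"
    by (auto simp: in_keys_iff lookup split: if_splits)
  show thesis
  proof
    have "sum (Poly_Mapping.lookup e) UNIV \<le> N" if "e \<in> Poly_Mapping.keys P" for e
      using keys that by (auto simp: exps_def)
    then show "total_degree P \<le> N" unfolding total_degree_def by (intro Max.boundedI) auto
    fix \<zeta> :: "complex ^ 'i"
    have "poly_eval P \<zeta> = (\<Sum>e\<in>?E.
        Poly_Mapping.lookup P e * mono_eval \<zeta> (Poly_Mapping.lookup e))"
      unfolding poly_eval_def mono_eval_def
      by (intro sum.mono_neutral_left finE keys) (auto simp: in_keys_iff)
    also have "\<dots> = (\<Sum>e\<in>?E.
        C (Poly_Mapping.lookup e) * mono_eval \<zeta> (Poly_Mapping.lookup e))"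
      by (intro sum.cong) (auto simp: lookup)
    also have "\<dots> = (\<Sum>k\<in>exps N. C k * mono_eval \<zeta> k)"
      using sum.reindex[OF inj_on_subset[OF inj subset_UNIV], of "\<lambda>k. C k * mono_eval \<zeta> k" ?E]
      unfolding img by (simp add: o_def)
    finally show "poly_eval P \<zeta> = (\<Sum>k\<in>exps N. C k * mono_eval \<zeta> k)" .
  qed
qed

text \<open>Gaussian elimination on the coefficients: although \<open>A\<close> may be infinite, finitely many members
  control all the others, uniformly in the coefficients.\<close>

lemma finite_dominating_subfamily:
  fixes v :: "'a \<Rightarrow> 'e \<Rightarrow> complex"
  assumes "finite E"
  shows "\<exists>F C. F \<subseteq> A \<and> finite F \<and> C \<ge> 0 \<and>
    (\<forall>a\<in>A. \<forall>\<phi>. norm (\<Sum>e\<in>E. v a e * \<phi> e) \<le>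
      C * (\<Sum>e\<in>E. norm (v a e)) * (\<Sum>b\<in>F. norm (\<Sum>e\<in>E. v b e * \<phi> e)))"
  using assms
proof (induction E arbitrary: v rule: finite_induct)
  case empty
  show ?case by (intro exI[of _ "{}"] exI[of _ 0]) simp
next
  case (insert e E)
  show ?case
  proof (cases "\<forall>a\<in>A. v a e = 0")
    case True
    then have "(\<Sum>e\<in>insert e E. v a e * \<phi> e) = (\<Sum>e\<in>E. v a e * \<phi> e)"
      "(\<Sum>e\<in>insert e E. norm (v a e)) = (\<Sum>e\<in>E. norm (v a e))" if "a \<in> A" for a \<phi>
      using insert(1,2) that by simp_all
    moreover obtain F C where "F \<subseteq> A" "finite F" "C \<ge> 0"
      "\<forall>a\<in>A. \<forall>\<phi>. norm (\<Sum>e\<in>E. v a e * \<phi> e) \<le>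
        C * (\<Sum>e\<in>E. norm (v a e)) * (\<Sum>b\<in>F. norm (\<Sum>e\<in>E. v b e * \<phi> e))"
      using insert.IH[of v] by blast
    moreover have "(\<Sum>b\<in>F. norm (\<Sum>e\<in>insert e E. v b e * \<phi> e)) = (\<Sum>b\<in>F. norm (\<Sum>e\<in>E. v b e * \<phi> e))" for \<phi>
      using calculation(1,3) by (intro sum.cong refl) (metis subsetD)
    ultimately show ?thesis by (intro exI[of _ F] exI[of _ C]) simp
  next
    case False
    \<comment> \<open>\<open>z\<close> is the pivot row for column \<open>e\<close>;
      \<open>v'\<close> subtracts the multiple of it that clears this column.\<close>
    then obtain z where z: "z \<in> A" "v z e \<noteq> 0" by blast
    define m where "m = norm (v z e)"
    have m: "m > 0" using z by (simp add: m_def)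
    define v' where "v' a x = v a x - (v a e / v z e) * v z x" for a x
    define l where "l a \<phi> = (\<Sum>e\<in>insert e E. v a e * \<phi> e)" for a \<phi>
    define n where "n a = (\<Sum>e\<in>insert e E. norm (v a e))" for a
    have n0: "n a \<ge> 0" for a unfolding n_def by (intro sum_nonneg) auto
    have ne: "norm (v a e) \<le> n a" for a
      unfolding n_def using insert(1) by (intro member_le_sum) auto
    have nE: "(\<Sum>e\<in>E. norm (v a e)) \<le> n a" for a
      unfolding n_def using insert(1) by (intro sum_mono2) auto
    obtain F C where F: "F \<subseteq> A" "finite F" "C \<ge> 0"
      and IH: "\<And>a \<phi>. a \<in> A \<Longrightarrow> norm (\<Sum>e\<in>E. v' a e * \<phi> e) \<le>
        C * (\<Sum>e\<in>E. norm (v' a e)) * (\<Sum>b\<in>F. norm (\<Sum>e\<in>E. v' b e * \<phi> e))"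
      using insert.IH[of v'] by blast
    have l': "(\<Sum>e\<in>E. v' a e * \<phi> e) = l a \<phi> - (v a e / v z e) * l z \<phi>" for a \<phi>
    proof -
      have "(\<Sum>x\<in>E. v' a x * \<phi> x) = (\<Sum>x\<in>insert e E. v' a x * \<phi> x)"
        using insert(1,2) z by (simp add: v'_def)
      then show ?thesis
        unfolding l_def v'_def
        by (simp only: left_diff_distrib sum_subtractf sum_distrib_left mult.assoc)
    qed
    have n': "(\<Sum>x\<in>E. norm (v' a x)) \<le> n a * (1 + n z / m)" for a
    proof -
      have "(\<Sum>x\<in>E. norm (v' a x)) \<le> (\<Sum>x\<in>E. norm (v a x) + n a / m * norm (v z x))"
      proof (rule sum_mono)
        fix x
        have "norm (v' a x) \<le> norm (v a x) + norm (v a e) / m * norm (v z x)"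
          unfolding v'_def m_def using norm_triangle_ineq4[of "v a x" "v a e / v z e * v z x"]
          by (simp add: norm_mult norm_divide)
        also have "\<dots> \<le> norm (v a x) + n a / m * norm (v z x)"
          using m ne[of a] by (intro add_left_mono mult_right_mono divide_right_mono) auto
        finally show "norm (v' a x) \<le> norm (v a x) + n a / m * norm (v z x)" .
      qed
      also have "\<dots> = (\<Sum>x\<in>E. norm (v a x)) + n a / m * (\<Sum>x\<in>E. norm (v z x))"
        by (simp add: sum.distrib sum_distrib_left)
      also have "\<dots> \<le> n a + n a / m * n z"
        using nE n0 m by (intro add_mono mult_left_mono) auto
      finally show ?thesis by (simp add: algebra_simps)
    qed
    \<comment> \<open>The first summand is the induction bound for \<open>v'\<close>, with its two
      sums estimated by \<open>n'\<close> and \<open>F'\<close>. The term \<open>1 / m\<close> pays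
      for adding the pivot multiple back.\<close>
    define c where "c = C * (1 + n z / m) * (1 + (\<Sum>b\<in>F. n b / m)) + 1 / m"
    have c0: "c \<ge> 0" unfolding c_def using F(3) n0 m by (auto intro!: add_nonneg_nonneg mult_nonneg_nonneg sum_nonneg)
    have "norm (l a \<phi>) \<le> c * n a * (\<Sum>b\<in>insert z F. norm (l b \<phi>))" if a: "a \<in> A" for a \<phi>
    proof -
      let ?S = "\<Sum>b\<in>insert z F. norm (l b \<phi>)"
      have lo: "norm (l z \<phi>) \<le> ?S" using F(2) by (intro member_le_sum) auto
      have S0: "?S \<ge> 0" by (intro sum_nonneg) auto
      have SF: "(\<Sum>b\<in>F. norm (l b \<phi>)) \<le> ?S" using F(2) by (intro sum_mono2) auto
      have bound: "norm (v b e / v z e * l z \<phi>) \<le> n b / m * ?S" for b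
        unfolding norm_mult norm_divide m_def[symmetric]
        using ne[of b] lo m n0 by (intro mult_mono divide_right_mono) auto
      have "(\<Sum>b\<in>F. norm (\<Sum>e\<in>E. v' b e * \<phi> e)) \<le> (\<Sum>b\<in>F. norm (l b \<phi>) + n b / m * ?S)"
        unfolding l' by (intro sum_mono order.trans[OF norm_triangle_ineq4] add_left_mono bound)
      also have "\<dots> \<le> ?S + (\<Sum>b\<in>F. n b / m) * ?S"
        using SF by (simp add: sum.distrib sum_distrib_right)
      finally have F': "(\<Sum>b\<in>F. norm (\<Sum>e\<in>E. v' b e * \<phi> e)) \<le> (1 + (\<Sum>b\<in>F. n b / m)) * ?S"
        by (simp add: algebra_simps)
      have "norm (l a \<phi>) \<le> norm (l a \<phi> - v a e / v z e * l z \<phi>) + norm (v a e / v z e * l z \<phi>)"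
        using norm_triangle_ineq[of "l a \<phi> - v a e / v z e * l z \<phi>" "v a e / v z e * l z \<phi>"] by simp
      also have "\<dots> \<le> C * (n a * (1 + n z / m)) * ((1 + (\<Sum>b\<in>F. n b / m)) * ?S) + n a / m * ?S"
      proof (intro add_mono bound)
        have "norm (l a \<phi> - v a e / v z e * l z \<phi>) \<le>
            C * (\<Sum>e\<in>E. norm (v' a e)) * (\<Sum>b\<in>F. norm (\<Sum>e\<in>E. v' b e * \<phi> e))"
          using IH[OF a, of \<phi>] unfolding l' .
        also have "\<dots> \<le> C * (n a * (1 + n z / m)) * ((1 + (\<Sum>b\<in>F. n b / m)) * ?S)"
          using F(3) n0 m by (intro mult_mono mult_left_mono n' F' mult_nonneg_nonneg add_nonneg_nonneg sum_nonneg) auto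
        finally show "norm (l a \<phi> - v a e / v z e * l z \<phi>) \<le> \<dots>" .
      qed
      also have "\<dots> = c * n a * ?S" by (simp add: c_def algebra_simps)
      finally show ?thesis .
    qed
    then show ?thesis
      using F(1,2) z(1) c0 unfolding l_def n_def
      by (intro exI[of _ "insert z F"] exI[of _ c]) auto
  qed
qed

text \<open>Finitely many hyperplanes do not cover the space; this later separates a point from all
  intersection points by a single linear form. In the induction, \<open>x\<close> moves along an
  axis on which \<open>w i\<close> is nonzero.\<close>

lemma avoid_hyperplanes:
  fixes w :: "'j \<Rightarrow> complex ^ 'm::finite"
  assumes "finite J" "\<And>j. j \<in> J \<Longrightarrow> w j \<noteq> 0"
  shows "\<exists>x. \<forall>j\<in>J. (\<Sum>r\<in>UNIV. x $ r * w j $ r) \<noteq> 0"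
  using assms
proof (induction J rule: finite_induct)
  case empty
  then show ?case by simp
next
  case (insert i J)
  then obtain x where x: "\<forall>j\<in>J. (\<Sum>r\<in>UNIV. x $ r * w j $ r) \<noteq> 0" by auto
  obtain r0 where r0: "w i $ r0 \<noteq> 0" using insert.prems[of i] by (auto simp: vec_eq_iff)
  \<comment> \<open>None of these polynomials in the displacement is zero: for \<open>j\<close> in
    \<open>J\<close> the constant term is nonzero, for \<open>i\<close> the linear coefficient
    is.\<close>
  let ?p = "\<lambda>j. [:\<Sum>r\<in>UNIV. x $ r * w j $ r, w j $ r0:]"
  have "finite (\<Union>j\<in>insert i J. {t. poly (?p j) t = 0})"
    using insert(1) x r0 by (intro finite_UN_I poly_roots_finite) auto
  then obtain t where t: "t \<notin> (\<Union>j\<in>insert i J. {t. poly (?p j) t = 0})"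
    using ex_new_if_finite[OF infinite_UNIV_char_0] by blast
  have "(\<Sum>r\<in>UNIV. (x + axis r0 t) $ r * w j $ r) = poly (?p j) t" for j
  proof -
    have "(\<Sum>r\<in>UNIV. axis r0 t $ r * w j $ r) = (\<Sum>r\<in>UNIV. if r = r0 then t * w j $ r else 0)"
      by (intro sum.cong) (auto simp: axis_def)
    then show ?thesis by (simp add: distrib_right sum.distrib)
  qed
  then show ?case using t by (intro exI[of _ "x + axis r0 t"]) auto
qed

section \<open>Differentiability of the intersection points\<close>

lemma bounded_linear_axis: "bounded_linear (axis i :: 'a::euclidean_space \<Rightarrow> 'a ^ 'i::finite)"
  by (intro linear_conv_bounded_linear[THEN iffD1] linearI) (auto simp: vec_eq_iff axis_def)

lemma has_derivative_vec_components:
  fixes f :: "'b::real_normed_vector \<Rightarrow> 'a::euclidean_space ^ 'i::finite"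
  assumes "\<And>i. ((\<lambda>x. f x $ i) has_derivative D i) F"
  shows "(f has_derivative (\<lambda>v. \<chi> i. D i v)) F"
proof -
  have sum: "x = (\<Sum>i\<in>UNIV. axis i (x $ i))" for x :: "'a ^ 'i"
    by (simp add: vec_eq_iff axis_def)
  have "((\<lambda>x. \<Sum>i\<in>UNIV. axis i (f x $ i)) has_derivative (\<lambda>v. \<Sum>i\<in>UNIV. axis i (D i v))) F"
    by (intro has_derivative_sum bounded_linear.has_derivative[OF bounded_linear_axis] assms)
  moreover have "(\<chi> i. D i v) = (\<Sum>i\<in>UNIV. axis i (D i v))" for v
    using sum[of "\<chi> i. D i v"] by simp
  ultimately show ?thesis using sum by simp
qed

lemma mv_holomorphic_on_vec:
  fixes f :: "complex ^ 'a::finite \<Rightarrow> complex ^ 'b::finite"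
  assumes "\<forall>i. mv_holomorphic_on (\<lambda>x. f x $ i) U" "x \<in> U"
  obtains D where "(f has_derivative D) (at x)" "\<And>c v. D (c *s v) = c *s D v"
proof -
  have "\<forall>i. \<exists>d. ((\<lambda>x. f x $ i) has_derivative d) (at x) \<and> (\<forall>c v. d (c *s v) = c * d v)"
    using assms unfolding mv_holomorphic_on_def by blast
  then obtain d where d: "\<And>i. ((\<lambda>x. f x $ i) has_derivative d i) (at x)"
    "\<And>i c v. d i (c *s v) = c * d i v" by metis
  show thesis
    by (rule that[OF has_derivative_vec_components[OF d(1)]]) (simp add: vec_eq_iff d(2))
qed

text \<open>The \<beta> for which \<open>L \<alpha> \<beta>\<close> passes through \<zeta>.\<close>

definition intercept ::
  "complex ^ ('q \<times> 'm) \<Rightarrow> complex ^ ('q::finite + 'm::finite) \<Rightarrow> complex ^ 'q"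
  where "intercept \<alpha> \<zeta> = (\<chi> k. \<zeta> $ Inl k - (\<Sum>r\<in>UNIV. \<alpha> $ (k, r) * \<zeta> $ Inr r))"

lemma mem_L_iff: "\<zeta> \<in> L \<alpha> \<beta> \<longleftrightarrow> intercept \<alpha> \<zeta> = \<beta>"
  by (auto simp: L_def intercept_def vec_eq_iff algebra_simps)

lemma intercept_add: "intercept \<alpha> (v + w) = intercept \<alpha> v + intercept \<alpha> w"
  by (simp add: intercept_def vec_eq_iff distrib_left sum.distrib)

lemma intercept_scale: "intercept \<alpha> (c *s v) = c *s intercept \<alpha> v"
  by (simp add: intercept_def vec_eq_iff right_diff_distrib sum_distrib_left mult.left_commute)

lemma linear_intercept: "linear (intercept \<alpha>)"
  by (rule linearI[OF intercept_add])
    (simp add: intercept_def vec_eq_iff scaleR_diff_right scaleR_sum_right)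

lemma intercept_has_derivative:
  fixes f :: "'b::real_normed_vector \<Rightarrow> complex ^ ('q::finite \<times> 'm::finite)"
  assumes "(f has_derivative f') (at x)" "(g has_derivative g') (at x)"
  shows "((\<lambda>x. intercept (f x) (g x)) has_derivative
    (\<lambda>v. intercept (f x) (g' v) - (\<chi> k. \<Sum>r\<in>UNIV. f' v $ (k, r) * g x $ Inr r))) (at x)"
proof -
  note nth = bounded_linear.has_derivative[OF bounded_linear_vec_nth]
  have "((\<lambda>x. intercept (f x) (g x)) has_derivative
    (\<lambda>v. \<chi> k. g' v $ Inl k - (\<Sum>r\<in>UNIV. f x $ (k, r) * g' v $ Inr r + f' v $ (k, r) * g x $ Inr r))) (at x)"
    by (rule has_derivative_vec_components)
      (simp add: intercept_def, intro has_derivative_diff has_derivative_sum has_derivative_mult nth assms)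
  moreover have "(\<chi> k. g' v $ Inl k - (\<Sum>r\<in>UNIV. f x $ (k, r) * g' v $ Inr r + f' v $ (k, r) * g x $ Inr r))
    = intercept (f x) (g' v) - (\<chi> k. \<Sum>r\<in>UNIV. f' v $ (k, r) * g x $ Inr r)" for v
    by (simp add: vec_eq_iff intercept_def sum.distrib)
  ultimately show ?thesis by simp
qed

text \<open>Along a curve in the plane the intercept is constantly \<beta>. As
  \<open>intercept \<alpha>\<close> is linear, it annihilates the velocity.\<close>

lemma tangent_space_L:
  assumes "v \<in> tangent_space (L \<alpha> \<beta>) x"
  shows "intercept \<alpha> v = 0"
proof -
  obtain c where c: "\<forall>\<^sub>F t in nhds 0. c t \<in> L \<alpha> \<beta>" "(c has_vector_derivative v) (at (0::real))"
    using assms unfolding tangent_space_def by blast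
  have bl: "bounded_linear (intercept \<alpha>)"
    using linear_intercept linear_conv_bounded_linear by blast
  have "((\<lambda>t. intercept \<alpha> (c t)) has_vector_derivative intercept \<alpha> v) (at 0)"
    by (rule bounded_linear.has_vector_derivative[OF bl c(2)])
  moreover have "((\<lambda>t. intercept \<alpha> (c t)) has_vector_derivative 0) (at 0)"
  proof -
    have ev: "\<forall>\<^sub>F t in nhds 0. intercept \<alpha> (c t) = \<beta>"
      using c(1) by (simp add: mem_L_iff)
    have "((\<lambda>_. \<beta>) has_vector_derivative 0) (at (0::real))" by (rule has_vector_derivative_const)
    moreover have "((\<lambda>t. intercept \<alpha> (c t)) has_vector_derivative 0) (at 0) \<longleftrightarrow>
        ((\<lambda>_. \<beta>) has_vector_derivative 0) (at 0)"
      by (rule has_vector_derivative_cong_ev)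
        (use ev eventually_nhds_x_imp_x[OF ev] in simp_all)
    ultimately show ?thesis by blast
  qed
  ultimately show ?thesis by (rule vector_derivative_unique_at)
qed

text \<open>\<open>f\<close> parametrises \<open>S\<close> near \<open>x\<close> and
  \<open>\<pi>\<close> recovers the parameter. A curve \<open>c\<close> in \<open>S\<close> equals
  \<open>f (\<pi> (c t))\<close> for small \<open>t\<close>, and the chain rule gives
  \<open>v = f' (\<pi>' v)\<close>.\<close>

lemma tangent_space_parametrised:
  assumes v: "v \<in> tangent_space S x" and "open U" "x \<in> U"
    and retract: "\<And>y. y \<in> S \<inter> U \<Longrightarrow> f (\<pi> y) = y"
    and \<pi>: "(\<pi> has_derivative \<pi>') (at x)" and f: "(f has_derivative f') (at (\<pi> x))"
  shows "v \<in> range f'"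
proof -
  obtain c where c: "c 0 = x" "\<forall>\<^sub>F t in nhds 0. c t \<in> S" "(c has_vector_derivative v) (at (0::real))"
    using v unfolding tangent_space_def by blast
  have dc: "(c has_derivative (\<lambda>t. t *\<^sub>R v)) (at 0)"
    using c(3) by (simp add: has_vector_derivative_def)
  have "((\<lambda>t. f (\<pi> (c t))) has_derivative (\<lambda>t. f' (\<pi>' (t *\<^sub>R v)))) (at 0)"
    using has_derivative_compose[OF has_derivative_compose[OF dc, of \<pi> \<pi>'], of f f'] \<pi> f c(1) by simp
  moreover have "f' (\<pi>' (t *\<^sub>R v)) = t *\<^sub>R f' (\<pi>' v)" for t
    using has_derivative_linear[OF \<pi>] has_derivative_linear[OF f] by (simp add: linear_scale)
  ultimately have 1: "((\<lambda>t. f (\<pi> (c t))) has_vector_derivative f' (\<pi>' v)) (at 0)"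
    by (simp add: has_vector_derivative_def)
  have "(c \<longlongrightarrow> c 0) (at 0)"
    using has_derivative_continuous[OF dc] by (simp add: isCont_def)
  then have "(c \<longlongrightarrow> c 0) (nhds 0)" by (simp add: tendsto_at_iff_tendsto_nhds)
  then have "\<forall>\<^sub>F t in nhds 0. c t \<in> U"
    using \<open>open U\<close> \<open>x \<in> U\<close> c(1) by (auto simp: tendsto_def)
  with c(2) have ev: "\<forall>\<^sub>F t in nhds 0. f (\<pi> (c t)) = c t"
    by eventually_elim (simp add: retract)
  have "((\<lambda>t. f (\<pi> (c t))) has_vector_derivative f' (\<pi>' v)) (at 0) \<longleftrightarrow>
      (c has_vector_derivative f' (\<pi>' v)) (at 0)"
    by (rule has_vector_derivative_cong_ev)
      (use ev eventually_nhds_x_imp_x[OF ev] in simp_all)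
  then have "(c has_vector_derivative f' (\<pi>' v)) (at 0)" using 1 by blast
  then have "v = f' (\<pi>' v)" using c(3) vector_derivative_unique_at by blast
  then show ?thesis by blast
qed

text \<open>In a chart of \<open>\<gamma>\<close> with parameter \<open>y\<close>, the map sending \<open>(\<alpha>, y)\<close> to \<open>(\<alpha>, \<beta>)\<close>, where
  \<open>L \<alpha> \<beta>\<close> is the plane with slope \<open>\<alpha>\<close> through the point with parameter \<open>y\<close>, is injective because
  the intersection point is unique, and its derivative is onto by transversality. Therefore its
  inverse is differentiable, although continuity of the derivative is not available.\<close>

lemma section_differentiable:
  fixes \<gamma> :: "(complex ^ ('q::finite + 'm::finite)) set"
    and p :: "complex ^ ('q \<times> 'm) \<Rightarrow> complex ^ 'q \<Rightarrow> complex ^ ('q + 'm)"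
  assumes sub: "complex_submanifold CARD('q) \<gamma>"
    and tr: "\<forall>\<^sub>F (\<alpha>, \<beta>) in nhds (0, 0).
      L \<alpha> \<beta> \<inter> \<gamma> = {p \<alpha> \<beta>} \<and> transversal_at \<gamma> (L \<alpha> \<beta>) (p \<alpha> \<beta>)"
  shows "\<forall>\<^sub>F x in nhds (0, 0). \<exists>D. ((\<lambda>x. p (fst x) (snd x)) has_derivative D) (at x) \<and>
    (\<forall>c a b. D (c *s a, c *s b) = c *s D (a, b))"
proof -
  obtain N where N: "open N" "(0, 0) \<in> N"
    and NP: "\<forall>x\<in>N. case x of (\<alpha>, \<beta>) \<Rightarrow>
      L \<alpha> \<beta> \<inter> \<gamma> = {p \<alpha> \<beta>} \<and> transversal_at \<gamma> (L \<alpha> \<beta>) (p \<alpha> \<beta>)"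
    using tr unfolding eventually_nhds by blast
  have sect: "L \<alpha> \<beta> \<inter> \<gamma> = {p \<alpha> \<beta>}"
    and transv: "transversal_at \<gamma> (L \<alpha> \<beta>) (p \<alpha> \<beta>)" if "(\<alpha>, \<beta>) \<in> N" for \<alpha> \<beta>
    using bspec[OF NP that] by simp_all
  have p0: "p 0 0 \<in> \<gamma>" "p 0 0 \<in> L 0 0" using sect[OF N(2)] by auto
  obtain U V \<phi> \<psi> and I :: "('q + 'm) set" where p0U: "p 0 0 \<in> U" and bi: "biholomorphism U V \<phi> \<psi>"
    and card: "card I = CARD('q)" and straight: "\<phi> ` (\<gamma> \<inter> U) = {z\<in>V. \<forall>i. i \<notin> I \<longrightarrow> z $ i = 0}"
    using bspec[OF sub[unfolded complex_submanifold_def] p0(1)] by blast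
  have U: "open U" and V: "open V" and \<psi>\<phi>: "\<And>x. x \<in> U \<Longrightarrow> \<psi> (\<phi> x) = x" and \<phi>\<psi>: "\<And>y. y \<in> V \<Longrightarrow> \<phi> (\<psi> y) = y"
    and hol\<phi>: "\<forall>i. mv_holomorphic_on (\<lambda>x. \<phi> x $ i) U" and hol\<psi>: "\<forall>i. mv_holomorphic_on (\<lambda>y. \<psi> y $ i) V"
    using bi unfolding biholomorphism_def by blast+
  \<comment> \<open>A bijection between \<open>'q\<close> and \<open>I\<close> identifies the
    coordinate plane that models \<gamma> with \<open>complex ^ 'q\<close>, through
    \<open>emb\<close> and \<open>prj\<close>.\<close>
  obtain \<sigma> :: "'q \<Rightarrow> 'q + 'm" where \<sigma>: "bij_betw \<sigma> UNIV I"
    using finite_same_card_bij[of "UNIV :: 'q set" I] card by auto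
  define \<tau> where "\<tau> = inv_into UNIV \<sigma>"
  have \<tau>\<sigma>: "\<tau> (\<sigma> k) = k" for k using \<sigma> by (simp add: \<tau>_def bij_betw_def)
  have \<sigma>\<tau>: "\<sigma> (\<tau> i) = i" if "i \<in> I" for i
    using \<sigma> that by (simp add: \<tau>_def bij_betw_def f_inv_into_f)
  have \<sigma>I: "\<sigma> k \<in> I" for k using \<sigma> by (auto simp: bij_betw_def)
  define emb :: "complex ^ 'q \<Rightarrow> complex ^ ('q + 'm)" where "emb y = (\<chi> i. if i \<in> I then y $ \<tau> i else 0)" for y
  define prj :: "complex ^ ('q + 'm) \<Rightarrow> complex ^ 'q" where "prj z = (\<chi> k. z $ \<sigma> k)" for z
  have emb_lin: "bounded_linear emb"
    by (intro linear_conv_bounded_linear[THEN iffD1] linearI) (auto simp: emb_def vec_eq_iff)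
  have prj_lin: "bounded_linear prj"
    by (intro linear_conv_bounded_linear[THEN iffD1] linearI) (auto simp: prj_def vec_eq_iff)
  have emb_scale: "emb (c *s y) = c *s emb y" for c y by (simp add: emb_def vec_eq_iff)
  have prj_emb: "prj (emb y) = y" for y by (simp add: prj_def emb_def vec_eq_iff \<sigma>I \<tau>\<sigma>)
  have emb_prj: "emb (prj z) = z" if "\<forall>i. i \<notin> I \<longrightarrow> z $ i = 0" for z
    using that by (simp add: prj_def emb_def vec_eq_iff \<sigma>\<tau>)
  have in_\<gamma>: "\<psi> (emb y) \<in> \<gamma>" if "emb y \<in> V" for y
  proof -
    have "emb y \<in> \<phi> ` (\<gamma> \<inter> U)" unfolding straight using that by (simp add: emb_def)
    then show ?thesis using \<psi>\<phi> by auto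
  qed
  have param: "emb (prj (\<phi> x)) = \<phi> x" "\<phi> x \<in> V" if "x \<in> \<gamma> \<inter> U" for x
  proof -
    have "\<phi> x \<in> {z\<in>V. \<forall>i. i \<notin> I \<longrightarrow> z $ i = 0}" using that straight by blast
    then show "emb (prj (\<phi> x)) = \<phi> x" "\<phi> x \<in> V" using emb_prj by auto
  qed
  define \<Phi> where "\<Phi> x = (fst x, intercept (fst x) (\<psi> (emb (snd x))))" for x :: "(complex ^ ('q \<times> 'm)) \<times> (complex ^ 'q)"
  define S0 where "S0 = {x :: (complex ^ ('q \<times> 'm)) \<times> (complex ^ 'q). emb (snd x) \<in> V}"
  have "open S0"
  proof -
    have "S0 = (\<lambda>x. emb (snd x)) -` V" by (auto simp: S0_def)
    moreover have "continuous_on UNIV (\<lambda>x :: (complex ^ ('q \<times> 'm)) \<times> (complex ^ 'q). emb (snd x))"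
      by (intro bounded_linear.continuous_on[OF emb_lin] continuous_on_snd continuous_on_id)
    ultimately show ?thesis using V open_vimage by metis
  qed
  have d\<Phi>: "\<exists>E. (\<psi> has_derivative E) (at (emb (snd x))) \<and> (\<forall>c v. E (c *s v) = c *s E v) \<and>
    (\<Phi> has_derivative (\<lambda>v. (fst v, intercept (fst x) (E (emb (snd v))) -
      (\<chi> k. \<Sum>r\<in>UNIV. fst v $ (k, r) * \<psi> (emb (snd x)) $ Inr r)))) (at x)"
    if x: "x \<in> S0" for x
  proof -
    obtain E where E: "(\<psi> has_derivative E) (at (emb (snd x)))" "\<And>c v. E (c *s v) = c *s E v"
      using x by (auto simp: S0_def intro: mv_holomorphic_on_vec[OF hol\<psi>])
    have "((\<lambda>x. emb (snd x)) has_derivative (\<lambda>v. emb (snd v))) (at x)"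
      by (intro bounded_linear.has_derivative[OF emb_lin] has_derivative_snd has_derivative_ident)
    then have "((\<lambda>x. \<psi> (emb (snd x))) has_derivative (\<lambda>v. E (emb (snd v)))) (at x)"
      using E(1) by (rule has_derivative_compose)
    from intercept_has_derivative[OF has_derivative_fst[OF has_derivative_ident] this]
    have "(\<Phi> has_derivative (\<lambda>v. (fst v, intercept (fst x) (E (emb (snd v))) -
      (\<chi> k. \<Sum>r\<in>UNIV. fst v $ (k, r) * \<psi> (emb (snd x)) $ Inr r)))) (at x)"
      unfolding \<Phi>_def by (intro has_derivative_Pair has_derivative_fst has_derivative_ident)
    then show ?thesis using E by blast
  qed
  have cont: "continuous_on S0 \<Phi>"
  proof (intro continuous_at_imp_continuous_on ballI)
    show "isCont \<Phi> x" if "x \<in> S0" for x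
      using d\<Phi>[OF that] has_derivative_continuous by (elim exE conjE)
  qed
  define S where "S = S0 \<inter> \<Phi> -` N"
  have "open S" unfolding S_def by (rule continuous_open_preimage[OF cont \<open>open S0\<close> N(1)])
  have p_\<Phi>: "p (fst (\<Phi> x)) (snd (\<Phi> x)) = \<psi> (emb (snd x))" if "x \<in> S" for x
  proof -
    have "\<psi> (emb (snd x)) \<in> L (fst (\<Phi> x)) (snd (\<Phi> x)) \<inter> \<gamma>"
      using that in_\<gamma> by (auto simp: S_def S0_def mem_L_iff \<Phi>_def)
    moreover have "(fst (\<Phi> x), snd (\<Phi> x)) \<in> N" using that by (simp add: S_def)
    then have "L (fst (\<Phi> x)) (snd (\<Phi> x)) \<inter> \<gamma> = {p (fst (\<Phi> x)) (snd (\<Phi> x))}" by (rule sect)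
    ultimately show ?thesis by simp
  qed
  \<comment> \<open>The inverse of \<open>\<Phi>\<close> on \<open>S\<close>: the chart returns the
    parameter of the intersection point.\<close>
  define g where "g t = (fst t, prj (\<phi> (p (fst t) (snd t))))" for t
  have g\<Phi>: "g (\<Phi> x) = x" if "x \<in> S" for x
  proof -
    have "fst (\<Phi> x) = fst x" by (simp add: \<Phi>_def)
    moreover have "prj (\<phi> (p (fst (\<Phi> x)) (snd (\<Phi> x)))) = snd x"
      unfolding p_\<Phi>[OF that] using that by (simp add: S_def S0_def \<phi>\<psi> prj_emb)
    ultimately show ?thesis by (simp add: g_def prod_eq_iff)
  qed
  have cont_S: "continuous_on S \<Phi>" using cont by (rule continuous_on_subset) (simp add: S_def)
  \<comment> \<open>Source and target have the same real dimension, so the image of this continuous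
    injection on an open set is open.\<close>
  have "inj_on \<Phi> S" using g\<Phi> by (rule inj_on_inverseI)
  then have openT: "open (\<Phi> ` S)" using cont_S \<open>open S\<close> by (intro invariance_of_domain)
  have zeroT: "(0, 0) \<in> \<Phi> ` S"
  proof
    let ?x = "(0, prj (\<phi> (p 0 0))) :: (complex ^ ('q \<times> 'm)) \<times> (complex ^ 'q)"
    have "p 0 0 \<in> \<gamma> \<inter> U" using p0 p0U by simp
    note par = param[OF this]
    show eq: "(0, 0) = \<Phi> ?x"
      using p0(2) par \<psi>\<phi>[OF p0U] by (simp add: \<Phi>_def mem_L_iff)
    show "?x \<in> S" using par N(2) eq[symmetric] by (simp add: S_def S0_def)
  qed
  have "\<exists>D. ((\<lambda>t. p (fst t) (snd t)) has_derivative D) (at t) \<and>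
    (\<forall>c a b. D (c *s a, c *s b) = c *s D (a, b))" if t: "t \<in> \<Phi> ` S" for t
  proof -
    obtain x where x: "x \<in> S" "t = \<Phi> x" using t by blast
    obtain \<alpha> y where \<alpha>y: "x = (\<alpha>, y)" by fastforce
    define \<zeta> where "\<zeta> = \<psi> (emb y)"
    have tN: "t \<in> N" using x by (simp add: S_def)
    have t_eq: "t = (\<alpha>, intercept \<alpha> \<zeta>)" by (simp add: x(2) \<alpha>y \<Phi>_def \<zeta>_def)
    have p_t: "p \<alpha> (intercept \<alpha> \<zeta>) = \<zeta>" using p_\<Phi>[OF x(1)] by (simp add: \<alpha>y \<Phi>_def \<zeta>_def)
    have yV: "emb y \<in> V" using x(1) by (simp add: S_def S0_def \<alpha>y)
    define \<Phi>' where "\<Phi>' E v = (fst v, intercept \<alpha> (E (emb (snd v))) - (\<chi> k. \<Sum>r\<in>UNIV. fst v $ (k, r) * \<zeta> $ Inr r))"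
      for E :: "complex ^ ('q + 'm) \<Rightarrow> complex ^ ('q + 'm)" and v :: "(complex ^ ('q \<times> 'm)) \<times> (complex ^ 'q)"
    obtain E where E: "(\<psi> has_derivative E) (at (emb y))" "\<And>c v. E (c *s v) = c *s E v"
      and d: "(\<Phi> has_derivative \<Phi>' E) (at x)"
      using d\<Phi>[of x] x(1) unfolding \<Phi>'_def \<zeta>_def by (auto simp: S_def \<alpha>y)
    have \<zeta>U: "\<zeta> \<in> U" unfolding \<zeta>_def using bi yV unfolding biholomorphism_def by blast
    have emb_E: "((\<lambda>y. \<psi> (emb y)) has_derivative (\<lambda>v. E (emb v))) (at y)"
      using has_derivative_compose[OF bounded_linear.has_derivative[OF emb_lin has_derivative_ident], of \<psi> E] E(1) by simp
    obtain E' where E': "(\<phi> has_derivative E') (at \<zeta>)"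
      by (rule mv_holomorphic_on_vec[OF hol\<phi> \<zeta>U])
    have tangent: "\<exists>w. v = E (emb w)" if "v \<in> tangent_space \<gamma> \<zeta>" for v
    proof -
      have "v \<in> range (\<lambda>v. E (emb v))"
      proof (rule tangent_space_parametrised[OF that U \<zeta>U, of "\<lambda>y. \<psi> (emb y)" "\<lambda>x. prj (\<phi> x)"])
        show "\<psi> (emb (prj (\<phi> y))) = y" if "y \<in> \<gamma> \<inter> U" for y
          using param(1)[OF that] \<psi>\<phi> that by simp
        show "((\<lambda>x. prj (\<phi> x)) has_derivative (\<lambda>v. prj (E' v))) (at \<zeta>)"
          by (rule bounded_linear.has_derivative[OF prj_lin E'])
        have "prj (\<phi> \<zeta>) = y" unfolding \<zeta>_def \<phi>\<psi>[OF yV] by (rule prj_emb)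
        then show "((\<lambda>y. \<psi> (emb y)) has_derivative (\<lambda>v. E (emb v))) (at (prj (\<phi> \<zeta>)))"
          using emb_E by simp
      qed
      then show ?thesis by blast
    qed
    have "surj (\<Phi>' E)"
    proof -
      have "\<exists>v. \<Phi>' E v = (a, b)" for a b
      proof -
        \<comment> \<open>To reach \<open>(a, b)\<close>, take a vector \<open>?u\<close> of
          intercept \<open>?b\<close>. Transversality splits it into a tangent vector of \<gamma>,
          of the form \<open>E (emb z)\<close>, and one of the plane, whose intercept is zero; so
          \<open>(a, z)\<close> is a preimage.\<close>
        let ?b = "b + (\<chi> k. \<Sum>r\<in>UNIV. a $ (k, r) * \<zeta> $ Inr r)"
        let ?u = "(\<chi> i. case i of Inl k \<Rightarrow> ?b $ k | Inr r \<Rightarrow> 0) :: complex ^ ('q + 'm)"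
        have "transversal_at \<gamma> (L \<alpha> (intercept \<alpha> \<zeta>)) \<zeta>"
          using transv[of \<alpha> "intercept \<alpha> \<zeta>"] tN t_eq p_t by simp
        then obtain v w where vw: "?u = v + w" "v \<in> tangent_space \<gamma> \<zeta>"
          "w \<in> tangent_space (L \<alpha> (intercept \<alpha> \<zeta>)) \<zeta>"
          unfolding transversal_at_def by blast
        obtain z where z: "v = E (emb z)" using tangent[OF vw(2)] by blast
        have "?b = intercept \<alpha> ?u" by (simp add: intercept_def vec_eq_iff)
        also have "\<dots> = intercept \<alpha> (E (emb z))"
          unfolding vw(1) intercept_add tangent_space_L[OF vw(3)] z by simp
        finally have "\<Phi>' E (a, z) = (a, b)" by (simp add: \<Phi>'_def algebra_simps)
        then show ?thesis by blast
      qed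
      then show ?thesis unfolding surj_def by (metis surj_pair)
    qed
    moreover have lin: "linear (\<Phi>' E)" using d by (rule has_derivative_linear)
    ultimately obtain g' where g': "linear g'" "\<Phi>' E \<circ> g' = id"
      using linear_surjective_right_inverse by blast
    have inj: "inj (\<Phi>' E)" using \<open>surj (\<Phi>' E)\<close> lin by (intro linear_surj_imp_inj)
    have \<Phi>g: "\<Phi>' E (g' v) = v" for v using g'(2) by (metis comp_apply id_apply)
    \<comment> \<open>A right inverse of the derivative at \<open>x\<close>, with continuity of
      \<open>\<Phi>\<close> and its inverse \<open>g\<close> on \<open>S\<close>, suffices;
      derivatives at neighbouring points do not enter.\<close>
    have dg: "(g has_derivative g') (at t)"
      unfolding x(2) by (rule has_derivative_inverse_strong[OF \<open>open S\<close> x(1) cont_S g\<Phi> d g'(2)])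
    have snd_g: "((\<lambda>t. snd (g t)) has_derivative (\<lambda>v. snd (g' v))) (at t)"
      by (rule has_derivative_snd[OF dg])
    have "snd (g t) = y" using g\<Phi>[OF x(1)] x(2) \<alpha>y by simp
    then have "((\<lambda>t. \<psi> (emb (snd (g t)))) has_derivative (\<lambda>v. E (emb (snd (g' v))))) (at t)"
      using has_derivative_compose[OF snd_g, of "\<lambda>y. \<psi> (emb y)"] emb_E by simp
    then have "((\<lambda>t. p (fst t) (snd t)) has_derivative (\<lambda>v. E (emb (snd (g' v))))) (at t)"
    proof (rule has_derivative_transform_within_open[OF _ openT t])
      fix s assume "s \<in> \<Phi> ` S"
      then show "\<psi> (emb (snd (g s))) = p (fst s) (snd s)" using p_\<Phi> g\<Phi> by auto
    qed
    \<comment> \<open>\<open>\<Phi>' E\<close> commutes with complex scalars and is injective, hence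
      \<open>g'\<close> commutes with them as well.\<close>
    moreover have "E (emb (snd (g' (c *s a, c *s b)))) = c *s E (emb (snd (g' (a, b))))" for c a b
    proof -
      obtain a' b' where ab: "g' (a, b) = (a', b')" by fastforce
      have "\<Phi>' E (c *s a', c *s b') = (c *s fst (\<Phi>' E (a', b')), c *s snd (\<Phi>' E (a', b')))"
        by (simp add: \<Phi>'_def emb_scale E(2) intercept_scale vec_eq_iff sum_distrib_left
            right_diff_distrib mult.assoc)
      also have "\<dots> = \<Phi>' E (g' (c *s a, c *s b))" unfolding ab[symmetric] \<Phi>g by simp
      finally have "g' (c *s a, c *s b) = (c *s a', c *s b')" using inj by (simp add: inj_eq)
      then show ?thesis by (simp add: ab emb_scale E(2))
    qed
    ultimately show ?thesis by blast
  qed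
  then show ?thesis unfolding eventually_nhds using openT zeroT by blast
qed

section \<open>Defining polynomials\<close>

lemma pol_on_mono_eval: "pol_on A (\<Sum>i\<in>UNIV. k i) (\<lambda>z. mono_eval (a + z *s b) k)"
proof -
  have "pol_on A (\<Sum>i\<in>UNIV. Suc 0 * k i) (\<lambda>z. \<Prod>i\<in>UNIV. (a $ i + z * b $ i) ^ k i)"
    by (intro pol_on_prod pol_on_power pol_on_affine)
  then show ?thesis by (simp add: mono_eval_def)
qed

section \<open>Changes of slope, linear forms and norm bounds\<close>

definition act :: "complex ^ ('q \<times> 'm) \<Rightarrow> complex ^ ('q::finite + 'm::finite) \<Rightarrow> complex ^ 'q"
  where "act a \<zeta> = (\<chi> k. \<Sum>r\<in>UNIV. a $ (k, r) * \<zeta> $ Inr r)"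

text \<open>Only the last m coordinates enter; within a plane \<open>L \<alpha> \<beta>\<close> they
  determine the point.\<close>

definition lin_form :: "complex ^ 'm \<Rightarrow> complex ^ ('q::finite + 'm::finite) \<Rightarrow> complex"
  where "lin_form x \<zeta> = (\<Sum>r\<in>UNIV. x $ r * \<zeta> $ Inr r)"

lemma lin_form_add: "lin_form x (v + w) = lin_form x v + lin_form x w"
  by (simp add: lin_form_def distrib_left sum.distrib)

lemma lin_form_diff: "lin_form x (v - w) = lin_form x v - lin_form x w"
  by (simp add: lin_form_def right_diff_distrib sum_subtractf)

lemma lin_form_scale: "lin_form x (c *s v) = c * lin_form x v"
  by (simp add: lin_form_def sum_distrib_left mult.left_commute)

lemma bounded_linear_lin_form: "bounded_linear (lin_form x)"
  by (intro linear_conv_bounded_linear[THEN iffD1] linearI)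
    (simp_all add: lin_form_add, simp add: lin_form_def scaleR_sum_right)

lemma lin_form_axis: "lin_form (axis r 1) \<zeta> = \<zeta> $ Inr r"
proof -
  have "lin_form (axis r 1) \<zeta> = (\<Sum>r'\<in>UNIV. if r' = r then \<zeta> $ Inr r' else 0)"
    unfolding lin_form_def by (intro sum.cong) (auto simp: axis_def)
  then show ?thesis by simp
qed

lemma intercept_diff_left: "intercept (\<alpha> + a) \<zeta> = intercept \<alpha> \<zeta> - act a \<zeta>"
  by (simp add: intercept_def act_def vec_eq_iff distrib_right sum.distrib)

lemma norm_act_le:
  fixes a :: "complex ^ ('q::finite \<times> 'm::finite)"
  shows "norm (act a \<zeta>) \<le> real (CARD('q) * CARD('m)) * norm a * norm \<zeta>"
proof -
  have "norm (act a \<zeta>) \<le> (\<Sum>k\<in>UNIV. norm (act a \<zeta> $ k))" by (rule norm_le_sum_components)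
  also have "\<dots> \<le> (\<Sum>k\<in>(UNIV::'q set). \<Sum>r\<in>(UNIV::'m set). norm a * norm \<zeta>)"
    unfolding act_def vec_lambda_beta
    by (intro sum_mono sum_norm_le)
      (simp add: norm_mult mult_mono Finite_Cartesian_Product.norm_nth_le)
  finally show ?thesis by simp
qed

lemma norm_intercept_le:
  fixes \<alpha> :: "complex ^ ('q::finite \<times> 'm::finite)"
  assumes "norm \<alpha> \<le> 1"
  shows "norm (intercept \<alpha> \<zeta>) \<le> real (CARD('q) * (1 + CARD('m))) * norm \<zeta>"
proof -
  let ?l = "\<chi> k. \<zeta> $ Inl k"
  have "norm ?l \<le> (\<Sum>k\<in>UNIV. norm (?l $ k))" by (rule norm_le_sum_components)
  also have "\<dots> \<le> (\<Sum>k\<in>(UNIV::'q set). norm \<zeta>)"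
    by (intro sum_mono) (simp add: Finite_Cartesian_Product.norm_nth_le)
  finally have 1: "norm ?l \<le> real CARD('q) * norm \<zeta>" by simp
  have "norm (act \<alpha> \<zeta>) \<le> real (CARD('q) * CARD('m)) * norm \<alpha> * norm \<zeta>" by (rule norm_act_le)
  also have "\<dots> \<le> real (CARD('q) * CARD('m)) * 1 * norm \<zeta>"
    using assms by (intro mult_right_mono mult_left_mono) auto
  finally have 2: "norm (act \<alpha> \<zeta>) \<le> real (CARD('q) * CARD('m)) * norm \<zeta>" by simp
  have "intercept \<alpha> \<zeta> = ?l - act \<alpha> \<zeta>" by (simp add: intercept_def act_def vec_eq_iff)
  then have "norm (intercept \<alpha> \<zeta>) \<le> norm ?l + norm (act \<alpha> \<zeta>)" using norm_triangle_ineq4 by simp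
  also have "\<dots> \<le> real CARD('q) * norm \<zeta> + real (CARD('q) * CARD('m)) * norm \<zeta>"
    by (intro add_mono 1 2)
  finally show ?thesis by (simp add: algebra_simps)
qed

text \<open>The hypotheses made uniform over balls of radius \<open>\<delta>\<close>.
  \<open>p_unique\<close> encodes that every admissible plane through an intersection point has that
  same point as its own, and \<open>DD\<close> is a choice of derivatives that commute with complex
  scalars.\<close>

locale plane_sections =
  fixes d D :: nat and \<delta> C :: real
    and p :: "nat \<Rightarrow> complex ^ ('q \<times> 'm) \<Rightarrow> complex ^ 'q \<Rightarrow> complex ^ ('q::finite + 'm::finite)"
    and h :: "'m \<Rightarrow> ('q \<Rightarrow> nat) \<Rightarrow> complex ^ ('q \<times> 'm) \<Rightarrow> complex"
    and DD :: "nat \<Rightarrow> complex ^ ('q \<times> 'm) \<Rightarrow> complex ^ 'q \<Rightarrow>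
      (complex ^ ('q \<times> 'm)) \<times> (complex ^ 'q) \<Rightarrow> complex ^ ('q + 'm)"
  assumes \<delta>: "\<delta> > 0" and C: "C \<ge> 0"
    and p_in_L: "\<And>j \<alpha> \<beta>. j \<in> {1..d} \<Longrightarrow> norm \<alpha> < \<delta> \<Longrightarrow> norm \<beta> < \<delta> \<Longrightarrow> intercept \<alpha> (p j \<alpha> \<beta>) = \<beta>"
    and p_unique: "\<And>j \<alpha> \<beta> \<alpha>' \<beta>'. j \<in> {1..d} \<Longrightarrow> norm \<alpha> < \<delta> \<Longrightarrow> norm \<beta> < \<delta> \<Longrightarrow>
      norm \<alpha>' < \<delta> \<Longrightarrow> norm \<beta>' < \<delta> \<Longrightarrow> intercept \<alpha>' (p j \<alpha> \<beta>) = \<beta>' \<Longrightarrow> p j \<alpha>' \<beta>' = p j \<alpha> \<beta>"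
    and p_bound: "\<And>j \<alpha> \<beta>. j \<in> {1..d} \<Longrightarrow> norm \<alpha> < \<delta> \<Longrightarrow> norm \<beta> < \<delta> \<Longrightarrow> norm (p j \<alpha> \<beta>) \<le> C"
    and p_deriv: "\<And>j \<alpha> \<beta>. j \<in> {1..d} \<Longrightarrow> norm \<alpha> < \<delta> \<Longrightarrow> norm \<beta> < \<delta> \<Longrightarrow>
      ((\<lambda>x. p j (fst x) (snd x)) has_derivative DD j \<alpha> \<beta>) (at (\<alpha>, \<beta>))"
    and p_deriv_scale: "\<And>j \<alpha> \<beta> c a b. j \<in> {1..d} \<Longrightarrow> norm \<alpha> < \<delta> \<Longrightarrow> norm \<beta> < \<delta> \<Longrightarrow>
      DD j \<alpha> \<beta> (c *s a, c *s b) = c *s DD j \<alpha> \<beta> (a, b)"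
    and trace: "\<And>\<alpha> \<beta> r. norm \<alpha> < \<delta> \<Longrightarrow> norm \<beta> < \<delta> \<Longrightarrow>
      (\<Sum>j=1..d. p j \<alpha> \<beta> $ Inr r) = (\<Sum>k\<in>exps (D + 1). h r k \<alpha> * mono_eval \<beta> k)"
begin

text \<open>The section \<open>p j\<close> is constant along the planes through a fixed point.\<close>

lemma p_deriv_act:
  assumes j: "j \<in> {1..d}" and \<alpha>: "norm \<alpha> < \<delta>" and \<beta>: "norm \<beta> < \<delta>"
  shows "DD j \<alpha> \<beta> (a, 0) = DD j \<alpha> \<beta> (0, act a (p j \<alpha> \<beta>))"
proof -
  let ?\<zeta> = "p j \<alpha> \<beta>" and ?E = "DD j \<alpha> \<beta>"
  define b where "b = act a ?\<zeta>"
  \<comment> \<open>All planes with parameters \<open>?c t\<close> pass through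
    \<open>?\<zeta>\<close>, since the shift by \<open>b\<close> compensates the change of slope. So
    \<open>p j\<close> is constant along this curve near \<open>t = 0\<close>.\<close>
  let ?c = "\<lambda>t::real. (\<alpha> + t *\<^sub>R a, \<beta> - t *\<^sub>R b)"
  note E = p_deriv[OF j \<alpha> \<beta>]
  have linE: "linear ?E" using E by (rule has_derivative_linear)
  have "(?c has_derivative (\<lambda>t. (0 + t *\<^sub>R a, 0 - t *\<^sub>R b))) (at 0)"
    by (intro has_derivative_Pair has_derivative_add has_derivative_diff has_derivative_const
        has_derivative_scaleR_left has_derivative_ident)
  from has_derivative_compose[OF this, of "\<lambda>x. p j (fst x) (snd x)" ?E] E
  have 1: "((\<lambda>t. p j (\<alpha> + t *\<^sub>R a) (\<beta> - t *\<^sub>R b)) has_derivative (\<lambda>t. ?E (t *\<^sub>R a, - t *\<^sub>R b))) (at 0)"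
    by simp
  have "((\<lambda>t. norm (\<alpha> + t *\<^sub>R a)) \<longlongrightarrow> norm (\<alpha> + 0 *\<^sub>R a)) (nhds (0::real))"
    "((\<lambda>t. norm (\<beta> - t *\<^sub>R b)) \<longlongrightarrow> norm (\<beta> - 0 *\<^sub>R b)) (nhds (0::real))"
    by (intro tendsto_intros filterlim_ident)+
  then have "\<forall>\<^sub>F t in nhds (0::real). norm (\<alpha> + t *\<^sub>R a) < \<delta>" "\<forall>\<^sub>F t in nhds (0::real). norm (\<beta> - t *\<^sub>R b) < \<delta>"
    using \<alpha> \<beta> by (auto intro: order_tendstoD(2))
  then have "\<forall>\<^sub>F t in nhds (0::real). ?\<zeta> = p j (\<alpha> + t *\<^sub>R a) (\<beta> - t *\<^sub>R b)"
  proof eventually_elim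
    case (elim t)
    have "act (t *\<^sub>R a) ?\<zeta> = t *\<^sub>R b"
      by (simp add: act_def b_def vec_eq_iff scaleR_sum_right)
    then have "intercept (\<alpha> + t *\<^sub>R a) ?\<zeta> = \<beta> - t *\<^sub>R b"
      using p_in_L[OF j \<alpha> \<beta>] by (simp add: intercept_diff_left)
    from p_unique[OF j \<alpha> \<beta> elim this] show ?case by simp
  qed
  then obtain T where T: "open T" "(0::real) \<in> T"
    "\<forall>t\<in>T. ?\<zeta> = p j (\<alpha> + t *\<^sub>R a) (\<beta> - t *\<^sub>R b)" unfolding eventually_nhds by blast
  have "((\<lambda>t. p j (\<alpha> + t *\<^sub>R a) (\<beta> - t *\<^sub>R b)) has_derivative (\<lambda>_. 0)) (at 0)"
    by (rule has_derivative_transform_within_open[OF has_derivative_const[of ?\<zeta>] T(1,2)]) (use T(3) in blast)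
  from has_derivative_unique[OF 1 this] have "?E (1 *\<^sub>R a, - 1 *\<^sub>R b) = 0" by metis
  moreover have "(a, 0) = (a, - b) + (0, b)" by simp
  then have "?E (a, 0) = ?E (a, - b) + ?E (0, b)" using linear_add[OF linE] by metis
  ultimately show ?thesis by (simp add: b_def)
qed

text \<open>In the slope direction with entries \<open>b $ k * x $ r\<close>, \<open>act\<close>
  returns \<open>lin_form x \<zeta>\<close> times \<open>b\<close>. Thus \<open>p_deriv_act\<close>
  becomes the Burgers equation for the linear form of each \<open>p j\<close>.\<close>

lemma esym_pol_on_line:
  assumes \<alpha>: "norm \<alpha> < \<delta>" and b: "norm \<beta> + 2 * norm b < \<delta>"
  shows "pol_on (ball 0 2) N (\<lambda>z. esym {1..d} (\<lambda>j. lin_form x (p j \<alpha> (\<beta> + z *s b))) N)"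
proof -
  define K where "K = (\<chi> i. b $ fst i * x $ snd i)"
  \<comment> \<open>An open neighbourhood of 0; the conclusion is read off at
    \<open>w = 0\<close>.\<close>
  define W where "W = {w. norm (\<alpha> + w *s K) < \<delta>}"
  let ?A = "\<lambda>w. \<alpha> + w *s K" and ?B = "\<lambda>z. \<beta> + z *s b"
  have smult: "bounded_linear (\<lambda>z. z *s y)" for y :: "complex ^ 'n::finite"
    by (intro linear_conv_bounded_linear[THEN iffD1] linearI) (auto simp: vec_eq_iff algebra_simps)
  have W: "open W"
  proof -
    have "continuous_on UNIV (\<lambda>w. norm (?A w))"
      by (intro continuous_intros bounded_linear.continuous_on[OF smult])
    then show ?thesis unfolding W_def by (intro open_Collect_less) auto
  qed
  have B: "norm (?B z) < \<delta>" if "z \<in> ball 0 2" for z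
  proof -
    have nz: "norm (z *s b) = norm z * norm b"
      by (simp add: norm_vec_def norm_mult L2_set_right_distrib)
    have "norm (?B z) \<le> norm \<beta> + norm z * norm b"
      using norm_triangle_ineq[of \<beta> "z *s b"] nz by simp
    also have "norm z * norm b \<le> 2 * norm b" using that by (intro mult_right_mono) auto
    finally show ?thesis using b by simp
  qed
  have act: "act K \<zeta> = lin_form x \<zeta> *s b" for \<zeta>
    by (simp add: act_def K_def lin_form_def vec_eq_iff sum_distrib_left sum_distrib_right ac_simps)
  interpret burgers "{1..d}" "\<lambda>j w z. lin_form x (p j (?A w) (?B z))"
    "\<lambda>j w z. lin_form x (DD j (?A w) (?B z) (0, b))" W 2
  proof
    fix j w z assume j: "j \<in> {1..d}" and w: "w \<in> W" and z: "z \<in> ball (0::complex) 2"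
    have A: "norm (?A w) < \<delta>" using w by (simp add: W_def)
    let ?E = "DD j (?A w) (?B z)"
    note E = p_deriv[OF j A B[OF z]] and Es = p_deriv_scale[OF j A B[OF z]]
    have "((\<lambda>z. (?A w, ?B z)) has_derivative (\<lambda>t. (0, 0 + t *s b))) (at z)"
      by (intro has_derivative_Pair has_derivative_add has_derivative_const
          bounded_linear.has_derivative[OF smult] has_derivative_ident)
    from bounded_linear.has_derivative[OF bounded_linear_lin_form
        has_derivative_compose[OF this, of "\<lambda>x. p j (fst x) (snd x)" ?E]] E
    have "((\<lambda>z. lin_form x (p j (?A w) (?B z))) has_derivative (\<lambda>t. lin_form x (?E (0, t *s b)))) (at z)"
      by simp
    moreover have "?E (0, t *s b) = t *s ?E (0, b)" for t using Es[of t 0 b] by simp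
    ultimately show "((\<lambda>z. lin_form x (p j (?A w) (?B z))) has_field_derivative lin_form x (?E (0, b))) (at z)"
      by (simp add: has_field_derivative_def lin_form_scale mult_commute_abs)
    have "((\<lambda>w. (?A w, ?B z)) has_derivative (\<lambda>t. (0 + t *s K, 0))) (at w)"
      by (intro has_derivative_Pair has_derivative_add has_derivative_const
          bounded_linear.has_derivative[OF smult] has_derivative_ident)
    from bounded_linear.has_derivative[OF bounded_linear_lin_form
        has_derivative_compose[OF this, of "\<lambda>x. p j (fst x) (snd x)" ?E]] E
    have "((\<lambda>w. lin_form x (p j (?A w) (?B z))) has_derivative (\<lambda>t. lin_form x (?E (t *s K, 0)))) (at w)"
      by simp
    moreover have "?E (t *s K, 0) = t *s (lin_form x (p j (?A w) (?B z)) *s ?E (0, b))" for t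
      using Es[of t K 0] Es[of "lin_form x (p j (?A w) (?B z))" 0 b] p_deriv_act[OF j A B[OF z], of K] act by simp
    ultimately show "((\<lambda>w. lin_form x (p j (?A w) (?B z))) has_field_derivative
        lin_form x (p j (?A w) (?B z)) * lin_form x (?E (0, b))) (at w)"
      by (simp add: has_field_derivative_def lin_form_scale mult_commute_abs mult.assoc)
  qed (use W in auto)
  \<comment> \<open>By the trace hypothesis the sum is a polynomial of degree at most
    \<open>D + 1\<close> in the intercept, hence in \<open>z\<close>.\<close>
  have "pol_on (ball 0 2) (D + 1) (\<lambda>z. \<Sum>j=1..d. lin_form x (p j (?A w) (?B z)))" if w: "w \<in> W" for w
  proof (rule pol_on_cong)
    show "pol_on (ball 0 2) (D + 1) (\<lambda>z. \<Sum>r\<in>UNIV. x $ r * (\<Sum>k\<in>exps (D + 1). h r k (?A w) * mono_eval (?B z) k))"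
      by (intro pol_on_sum pol_on_cmult pol_on_mono[OF pol_on_mono_eval]) (simp add: exps_def)
    fix z :: complex assume z: "z \<in> ball 0 2"
    have "(\<Sum>j=1..d. lin_form x (p j (?A w) (?B z))) = (\<Sum>r\<in>UNIV. \<Sum>j=1..d. x $ r * p j (?A w) (?B z) $ Inr r)"
      unfolding lin_form_def by (rule sum.swap)
    also have "\<dots> = (\<Sum>r\<in>UNIV. x $ r * (\<Sum>k\<in>exps (D + 1). h r k (?A w) * mono_eval (?B z) k))"
      using w B[OF z] by (simp only: sum_distrib_left[symmetric] trace W_def mem_Collect_eq)
    finally show "(\<Sum>j=1..d. lin_form x (p j (?A w) (?B z))) = \<dots>" .
  qed
  from esym_degree_le[OF this, of 0 N] show ?thesis using \<alpha> by (simp add: W_def)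
qed

text \<open>The points \<open>p j\<close> are taken on the plane of slope \<alpha> through \<zeta>,
  so they vary with \<zeta>; on a single plane of that slope they are fixed.\<close>

definition G where
  "G \<alpha> x \<zeta> = (\<Prod>j=1..d. lin_form x \<zeta> - lin_form x (p j \<alpha> (intercept \<alpha> \<zeta>)))"

text \<open>In the expansion by \<open>prod_diff_esym\<close>, a_N has degree at most N and is
  multiplied by the power d - N of an affine function. The factor 3 makes room for
  \<open>norm ?a + 2 * norm ?b\<close>, as \<open>esym_pol_on_line\<close> requires.\<close>

lemma line_pol_G:
  assumes \<alpha>: "norm \<alpha> < \<delta>" "norm \<alpha> \<le> 1" and R: "real (CARD('q) * (1 + CARD('m))) * R * 3 \<le> \<delta>"
  shows "line_pol R d (G \<alpha> x)"
  unfolding line_pol_def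
proof (intro allI impI)
  fix a b :: "complex ^ ('q + 'm)" assume a: "norm a < R" and b: "norm b < R"
  let ?M = "real (CARD('q) * (1 + CARD('m)))"
  let ?a = "intercept \<alpha> a" and ?b = "intercept \<alpha> b"
  have "?M > 0" by (simp only: of_nat_0_less_iff) simp
  then have lt: "?M * norm a < ?M * R" "?M * norm b < ?M * R" using a b by (simp_all del: of_nat_mult of_nat_add)
  have "norm ?a + 2 * norm ?b < \<delta>"
    using norm_intercept_le[OF \<alpha>(2), of a] norm_intercept_le[OF \<alpha>(2), of b] lt R by linarith
  note pol = esym_pol_on_line[OF \<alpha>(1) this, of _ x]
  have "pol_on (ball 0 2) d (\<lambda>z. \<Sum>N\<le>d. esym {1..d} (\<lambda>j. lin_form x (p j \<alpha> (?a + z *s ?b))) N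
      * (lin_form x a + z * lin_form x b) ^ (d - N))"
  proof (intro pol_on_sum)
    fix N assume "N \<in> {..d}"
    then have "N + Suc 0 * (d - N) = d" by simp
    then show "pol_on (ball 0 2) d (\<lambda>z. esym {1..d} (\<lambda>j. lin_form x (p j \<alpha> (?a + z *s ?b))) N
      * (lin_form x a + z * lin_form x b) ^ (d - N))"
      using pol_on_mult[OF pol[of N] pol_on_power[OF pol_on_affine, where k = "d - N"]] by simp
  qed
  then have "pol_on (cball 0 1) d (\<lambda>z. \<Sum>N\<le>d. esym {1..d} (\<lambda>j. lin_form x (p j \<alpha> (?a + z *s ?b))) N
      * (lin_form x a + z * lin_form x b) ^ (d - N))"
    by (rule pol_on_subset) auto
  then show "pol_on (cball 0 1) d (\<lambda>z. G \<alpha> x (a + z *s b))"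
  proof (rule pol_on_cong)
    fix z
    show "G \<alpha> x (a + z *s b) = (\<Sum>N\<le>d. esym {1..d} (\<lambda>j. lin_form x (p j \<alpha> (?a + z *s ?b))) N
      * (lin_form x a + z * lin_form x b) ^ (d - N))"
      unfolding G_def intercept_add intercept_scale lin_form_add lin_form_scale
      by (subst prod_diff_esym) simp_all
  qed
qed

text \<open>Being independent of \<alpha>, the bound yields, through
  \<open>multivariate_interpolation\<close>, coefficients bounded uniformly in \<alpha> when the
  linear form is a coordinate.\<close>

lemma norm_G_le:
  assumes \<alpha>: "norm \<alpha> < \<delta>" "norm \<alpha> \<le> 1" and R: "real (CARD('q) * (1 + CARD('m))) * R * 3 \<le> \<delta>"
    and \<zeta>: "norm \<zeta> < R"
  shows "norm (G \<alpha> (axis r 1) \<zeta>) \<le> (R + C) ^ d"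
proof -
  let ?M = "real (CARD('q) * (1 + CARD('m)))"
  have "?M > 0" by (simp only: of_nat_0_less_iff) simp
  then have "?M * norm \<zeta> < ?M * R" using \<zeta> by (simp del: of_nat_mult of_nat_add)
  then have i: "norm (intercept \<alpha> \<zeta>) < \<delta>"
    using norm_intercept_le[OF \<alpha>(2), of \<zeta>] R norm_ge_zero[of "intercept \<alpha> \<zeta>"] by linarith
  have "norm (G \<alpha> (axis r 1) \<zeta>) = (\<Prod>j=1..d. norm (\<zeta> $ Inr r - p j \<alpha> (intercept \<alpha> \<zeta>) $ Inr r))"
    by (simp add: G_def lin_form_axis prod_norm)
  also have "\<dots> \<le> (\<Prod>j=1..d. R + C)"
  proof (intro prod_mono conjI norm_ge_zero)
    fix j assume j: "j \<in> {1..d}"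
    have "norm (\<zeta> $ Inr r) \<le> R" using Finite_Cartesian_Product.norm_nth_le[of \<zeta> "Inr r"] \<zeta> by linarith
    moreover have "norm (p j \<alpha> (intercept \<alpha> \<zeta>) $ Inr r) \<le> C"
      using Finite_Cartesian_Product.norm_nth_le p_bound[OF j \<alpha>(1) i] order.trans by blast
    ultimately show "norm (\<zeta> $ Inr r - p j \<alpha> (intercept \<alpha> \<zeta>) $ Inr r) \<le> R + C"
      by (intro order.trans[OF norm_triangle_ineq4] add_mono)
  qed
  finally show ?thesis by simp
qed


text \<open>The polynomial is known to equal \<open>G\<close> only near the origin. On a plane of
  slope \<alpha> the intercept is constant, so both sides are polynomials along the line from a
  point near the origin to \<zeta>, and they agree near its start.\<close>

lemma poly_on_plane:
  assumes \<alpha>: "norm \<alpha> < \<delta>" and \<beta>: "norm \<beta> < \<delta>" and \<rho>: "real CARD('q) * norm \<beta> < \<rho>"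
    and repr: "\<And>\<zeta>. norm \<zeta> < \<rho> \<Longrightarrow> G \<alpha> x \<zeta> = (\<Sum>k\<in>exps M. c k * mono_eval \<zeta> k)"
    and \<zeta>: "intercept \<alpha> \<zeta> = \<beta>"
  shows "(\<Sum>k\<in>exps M. c k * mono_eval \<zeta> k) = (\<Prod>j=1..d. lin_form x \<zeta> - lin_form x (p j \<alpha> \<beta>))"
proof -
  define e :: "complex ^ ('q + 'm)" where "e = (\<chi> i. case i of Inl k \<Rightarrow> \<beta> $ k | Inr r \<Rightarrow> 0)"
  define v where "v = \<zeta> - e"
  have e: "intercept \<alpha> e = \<beta>" by (simp add: intercept_def e_def vec_eq_iff)
  then have v: "intercept \<alpha> v = 0"
    using \<zeta> linear_diff[OF linear_intercept, of \<alpha> \<zeta> e] by (simp add: v_def)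
  have "norm e \<le> (\<Sum>i\<in>UNIV. norm (e $ i))" by (rule norm_le_sum_components)
  also have "\<dots> = (\<Sum>k\<in>UNIV. norm (\<beta> $ k))"
    unfolding UNIV_Plus_UNIV[symmetric] by (subst sum.Plus) (simp_all add: e_def)
  also have "\<dots> \<le> (\<Sum>k\<in>(UNIV::'q set). norm \<beta>)"
    by (intro sum_mono Finite_Cartesian_Product.norm_nth_le)
  finally have ne: "norm e < \<rho>" using \<rho> by simp
  \<comment> \<open>For \<open>norm z < s\<close> the point \<open>e + z *s v\<close> stays in the
    ball of radius \<open>\<rho>\<close>; the summand 1 excludes division by zero.\<close>
  define s where "s = (\<rho> - norm e) / (norm v + 1)"
  have s: "s > 0" using ne by (simp add: s_def add_nonneg_pos)
  have near: "norm (e + z *s v) < \<rho>" if "z \<in> ball 0 s" for z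
  proof -
    have "norm (z *s v) = norm z * norm v"
      by (simp add: norm_vec_def norm_mult L2_set_right_distrib)
    also have "\<dots> \<le> norm z * (norm v + 1)" by (intro mult_left_mono) auto
    also have "\<dots> < \<rho> - norm e"
      using that by (simp add: s_def pos_less_divide_eq add_nonneg_pos)
    finally show ?thesis using norm_triangle_ineq[of e "z *s v"] by linarith
  qed
  \<comment> \<open>At \<open>z = 1\<close> the line reaches \<zeta>.\<close>
  have "(\<Sum>k\<in>exps M. c k * mono_eval (e + 1 *s v) k) =
      (\<Prod>j=1..d. (lin_form x e - lin_form x (p j \<alpha> \<beta>)) + 1 * lin_form x v)"
  proof (rule pol_on_eqI[OF _ _ infinite_ball_complex[OF s, of 0], where z = 1
        and f = "\<lambda>z. \<Sum>k\<in>exps M. c k * mono_eval (e + z *s v) k"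
        and g = "\<lambda>z. \<Prod>j=1..d. (lin_form x e - lin_form x (p j \<alpha> \<beta>)) + z * lin_form x v"])
    show "pol_on UNIV M (\<lambda>z. \<Sum>k\<in>exps M. c k * mono_eval (e + z *s v) k)"
      by (intro pol_on_sum pol_on_cmult pol_on_mono[OF pol_on_mono_eval]) (simp add: exps_def)
    show "pol_on UNIV (\<Sum>j=1..d. Suc 0) (\<lambda>z. \<Prod>j=1..d. (lin_form x e - lin_form x (p j \<alpha> \<beta>)) + z * lin_form x v)"
      by (intro pol_on_prod pol_on_affine)
    fix z :: complex assume "z \<in> ball 0 s"
    from repr[OF near[OF this]]
    show "(\<Sum>k\<in>exps M. c k * mono_eval (e + z *s v) k) =
        (\<Prod>j=1..d. (lin_form x e - lin_form x (p j \<alpha> \<beta>)) + z * lin_form x v)"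
      unfolding G_def intercept_add intercept_scale e v
      by (simp add: lin_form_add lin_form_scale algebra_simps)
  qed
  then show ?thesis by (simp add: v_def lin_form_diff)
qed

text \<open>The index \<open>r\<close> is that of the largest of the last coordinates. The first
  coordinates are affine in the last ones, with coefficients of modulus at most 1.\<close>

lemma coordinate_growth:
  fixes \<zeta> :: "complex ^ ('q + 'm)"
  assumes "norm \<alpha> \<le> 1" "norm \<beta> \<le> 1" "intercept \<alpha> \<zeta> = \<beta>"
  obtains r where "norm \<zeta> \<le> real (CARD('m) * (CARD('q) + 1)) * norm (\<zeta> $ Inr r) + real CARD('q)"
proof -
  let ?f = "\<lambda>r. norm (\<zeta> $ Inr r)"
  have "Max (range ?f) \<in> range ?f" by (rule Max_in) auto
  then obtain r where "Max (range ?f) = ?f r" by blast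
  moreover have "?f r' \<le> Max (range ?f)" for r' by (rule Max_ge) auto
  ultimately have r: "?f r' \<le> ?f r" for r' by simp
  have k: "norm (\<zeta> $ Inl k) \<le> real CARD('m) * ?f r + 1" for k
  proof -
    have "\<zeta> $ Inl k = (\<Sum>r'\<in>UNIV. \<alpha> $ (k, r') * \<zeta> $ Inr r') + \<beta> $ k"
      using assms(3) by (auto simp: intercept_def vec_eq_iff algebra_simps)
    also have "norm \<dots> \<le> (\<Sum>r'\<in>(UNIV::'m set). 1 * ?f r) + 1"
    proof (intro order.trans[OF norm_triangle_ineq] add_mono sum_norm_le)
      show "norm (\<alpha> $ (k, r') * \<zeta> $ Inr r') \<le> 1 * ?f r" for r'
        unfolding norm_mult using r assms(1) Finite_Cartesian_Product.norm_nth_le[of \<alpha> "(k, r')"]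
        by (intro mult_mono) auto
      show "norm (\<beta> $ k) \<le> 1"
        using assms(2) Finite_Cartesian_Product.norm_nth_le[of \<beta> k] by linarith
    qed
    finally show ?thesis by simp
  qed
  have "norm \<zeta> \<le> (\<Sum>i\<in>UNIV. norm (\<zeta> $ i))" by (rule norm_le_sum_components)
  also have "\<dots> = (\<Sum>k\<in>UNIV. norm (\<zeta> $ Inl k)) + (\<Sum>r\<in>UNIV. ?f r)"
    unfolding UNIV_Plus_UNIV[symmetric] by (subst sum.Plus) simp_all
  also have "\<dots> \<le> (\<Sum>k\<in>(UNIV::'q set). real CARD('m) * ?f r + 1) + (\<Sum>r'\<in>(UNIV::'m set). ?f r)"
    by (intro add_mono sum_mono k r)
  finally show thesis by (intro that[of r]) (simp add: algebra_simps)
qed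

text \<open>Each small slope \<alpha> and each linear form \<open>x\<close> give a polynomial
  \<open>Q (\<alpha>, x)\<close>, and a finite subfamily \<open>F\<close> controls all of them. So
  both claims may be argued with the slope of the plane at hand and a convenient \<open>x\<close>,
  even if that pair is not in \<open>F\<close>.\<close>

theorem defining_polynomials:
  "\<exists>(J :: nat set) (P :: nat \<Rightarrow> ('q + 'm) cpoly) (\<epsilon>::real) (\<kappa>::real) (K::real).
    finite J \<and> J \<noteq> {} \<and> (\<forall>\<iota>\<in>J. total_degree (P \<iota>) \<le> d) \<and> \<epsilon> > 0 \<and> \<kappa> > 0 \<and> K > 0 \<and>
    (\<forall>\<zeta>\<in>Gamma_cone \<epsilon>. norm \<zeta> \<ge> K \<longrightarrow>
       Max ((\<lambda>\<iota>. norm (poly_eval (P \<iota>) \<zeta>)) ` J) \<ge> \<kappa> * norm \<zeta> ^ d) \<and>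
    (\<forall>\<alpha> \<beta>. max (norm \<alpha>) (norm \<beta>) < \<epsilon> \<longrightarrow>
       L \<alpha> \<beta> \<inter> common_zeros J P = (\<lambda>j. p j \<alpha> \<beta>) ` {1..d})"
proof -
  define M where "M = real (CARD('q) * (1 + CARD('m)))"
  define R where "R = \<delta> / (3 * M)"
  have M: "M > 0" unfolding M_def by (simp only: of_nat_0_less_iff) simp
  have R: "R > 0" "M * R * 3 \<le> \<delta>" using \<delta> M by (simp_all add: R_def)
  obtain \<rho> W :: real where \<rho>: "\<rho> > 0" and W: "W \<ge> 0"
    and interp: "\<And>f :: complex ^ ('q + 'm) \<Rightarrow> complex. line_pol R d f \<Longrightarrow>
      \<exists>c. (\<forall>\<zeta>. norm \<zeta> < \<rho> \<longrightarrow> f \<zeta> = (\<Sum>k\<in>exps d. c k * mono_eval \<zeta> k)) \<and>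
        (\<forall>B. (\<forall>\<zeta>. norm \<zeta> < R \<longrightarrow> norm (f \<zeta>) \<le> B) \<longrightarrow> (\<forall>k\<in>exps d. norm (c k) \<le> W * B))"
    by (rule multivariate_interpolation[OF R(1), where 'i = "'q + 'm" and N = d]) (rule that; blast)
  \<comment> \<open>The last bound provides the condition
    \<open>CARD('q) * norm \<beta> < \<rho>\<close> of \<open>poly_on_plane\<close>.\<close>
  define \<delta>2 where "\<delta>2 = min (min \<delta> 1) (\<rho> / CARD('q))"
  have \<delta>2: "\<delta>2 > 0" "\<delta>2 \<le> \<delta>" "\<delta>2 \<le> 1" "\<delta>2 \<le> \<rho> / CARD('q)" using \<delta> \<rho> by (auto simp: \<delta>2_def)
  \<comment> \<open>A point \<open>p j \<alpha> \<beta>\<close> has norm at most \<open>C\<close>,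
    and two slopes below \<open>\<epsilon>\<close> differ by at most \<open>2 * \<epsilon>\<close>.
    Hence its intercept for the other slope is below
    \<open>\<epsilon> * X = \<delta>2\<close>.\<close>
  define X where "X = 1 + 2 * M * C"
  have X: "X \<ge> 1" using M C by (simp add: X_def)
  define \<epsilon> where "\<epsilon> = \<delta>2 / X"
  have "\<delta>2 / X \<le> \<delta>2 / 1" using X \<delta>2(1) by (intro divide_left_mono) auto
  then have \<epsilon>: "\<epsilon> > 0" "\<epsilon> \<le> \<delta>2" "\<epsilon> * X = \<delta>2"
    using \<delta>2(1) X by (simp_all add: \<epsilon>_def)
  define A where "A = {a :: (complex ^ ('q \<times> 'm)) \<times> (complex ^ 'm). norm (fst a) < \<epsilon>}"
  have A_small: "norm (fst a) < \<delta>" "norm (fst a) \<le> 1" if "a \<in> A" for a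
    using that \<epsilon> \<delta>2 by (auto simp: A_def)
  have "\<forall>a\<in>A. \<exists>c. (\<forall>\<zeta>. norm \<zeta> < \<rho> \<longrightarrow> G (fst a) (snd a) \<zeta> = (\<Sum>k\<in>exps d. c k * mono_eval \<zeta> k)) \<and>
      (\<forall>B. (\<forall>\<zeta>. norm \<zeta> < R \<longrightarrow> norm (G (fst a) (snd a) \<zeta>) \<le> B) \<longrightarrow> (\<forall>k\<in>exps d. norm (c k) \<le> W * B))"
  proof
    fix a assume a: "a \<in> A"
    show "\<exists>c. (\<forall>\<zeta>. norm \<zeta> < \<rho> \<longrightarrow> G (fst a) (snd a) \<zeta> = (\<Sum>k\<in>exps d. c k * mono_eval \<zeta> k)) \<and>
      (\<forall>B. (\<forall>\<zeta>. norm \<zeta> < R \<longrightarrow> norm (G (fst a) (snd a) \<zeta>) \<le> B) \<longrightarrow> (\<forall>k\<in>exps d. norm (c k) \<le> W * B))"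
      by (rule interp, rule line_pol_G[OF A_small[OF a] R(2)[unfolded M_def]])
  qed
  then have "\<exists>v. \<forall>a\<in>A. (\<forall>\<zeta>. norm \<zeta> < \<rho> \<longrightarrow> G (fst a) (snd a) \<zeta> = (\<Sum>k\<in>exps d. v a k * mono_eval \<zeta> k)) \<and>
      (\<forall>B. (\<forall>\<zeta>. norm \<zeta> < R \<longrightarrow> norm (G (fst a) (snd a) \<zeta>) \<le> B) \<longrightarrow> (\<forall>k\<in>exps d. norm (v a k) \<le> W * B))"
    by (rule bchoice)
  then obtain v where v: "\<And>a \<zeta>. a \<in> A \<Longrightarrow> norm \<zeta> < \<rho> \<Longrightarrow>
        G (fst a) (snd a) \<zeta> = (\<Sum>k\<in>exps d. v a k * mono_eval \<zeta> k)"
    and v_bound: "\<And>a B k. a \<in> A \<Longrightarrow> (\<forall>\<zeta>. norm \<zeta> < R \<longrightarrow> norm (G (fst a) (snd a) \<zeta>) \<le> B) \<Longrightarrow>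
        k \<in> exps d \<Longrightarrow> norm (v a k) \<le> W * B"
    by blast
  define Q where "Q a \<zeta> = (\<Sum>k\<in>exps d. v a k * mono_eval \<zeta> k)" for a \<zeta>
  have Q_plane: "Q a \<zeta> = (\<Prod>j=1..d. lin_form (snd a) \<zeta> - lin_form (snd a) (p j (fst a) (intercept (fst a) \<zeta>)))"
    if "a \<in> A" "norm (intercept (fst a) \<zeta>) < \<delta>2" for a \<zeta>
    unfolding Q_def
  proof (rule poly_on_plane[where \<rho> = \<rho>])
    show "norm (fst a) < \<delta>" using A_small that by blast
    show "norm (intercept (fst a) \<zeta>) < \<delta>" using that(2) \<delta>2 by linarith
    have "norm (intercept (fst a) \<zeta>) < \<rho> / CARD('q)" using that(2) \<delta>2 by linarith
    then show "real CARD('q) * norm (intercept (fst a) \<zeta>) < \<rho>"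
      by (simp add: pos_less_divide_eq mult.commute)
    show "G (fst a) (snd a) \<zeta> = (\<Sum>k\<in>exps d. v a k * mono_eval \<zeta> k)" if "norm \<zeta> < \<rho>" for \<zeta>
      by (rule v) fact+
  qed simp
  obtain F0 B where F0: "F0 \<subseteq> A" "finite F0" and B: "B \<ge> 0"
    and dom0: "\<And>a \<phi>. a \<in> A \<Longrightarrow> norm (\<Sum>k\<in>exps d. v a k * \<phi> k) \<le>
      B * (\<Sum>k\<in>exps d. norm (v a k)) * (\<Sum>b\<in>F0. norm (\<Sum>k\<in>exps d. v b k * \<phi> k))"
    using finite_dominating_subfamily[OF finite_exps[of d], where v = v and A = A] by blast
  \<comment> \<open>The extra member of \<open>A\<close> keeps \<open>F\<close> nonempty, so that
    \<open>Max\<close> is taken over a nonempty set.\<close>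
  define F where "F = insert (0, 0) F0"
  have F: "finite F" "F \<subseteq> A" "F \<noteq> {}" using F0 \<epsilon>(1) by (auto simp: F_def A_def)
  have dom: "norm (Q a \<zeta>) \<le> B * (\<Sum>k\<in>exps d. norm (v a k)) * (\<Sum>b\<in>F. norm (Q b \<zeta>))" if "a \<in> A" for a \<zeta>
  proof -
    have "(\<Sum>b\<in>F0. norm (Q b \<zeta>)) \<le> (\<Sum>b\<in>F. norm (Q b \<zeta>))"
      using F(1) by (intro sum_mono2) (auto simp: F_def)
    then show ?thesis
      using dom0[OF that, of "mono_eval \<zeta>"] B unfolding Q_def[symmetric]
      by (meson mult_left_mono mult_nonneg_nonneg norm_ge_zero order.trans sum_nonneg)
  qed
  obtain f where f: "bij_betw f {0..<card F} F" using ex_bij_betw_nat_finite[OF F(1)] by blast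
  define J where "J = {0..<card F}"
  have fJ: "f ` J = F" using f by (simp add: J_def bij_betw_def)
  have "\<exists>P. total_degree P \<le> d \<and> (\<forall>\<zeta>. poly_eval P \<zeta> = Q (f \<iota>) \<zeta>)" for \<iota>
    unfolding Q_def by (rule cpoly_of_coeffs[of d "v (f \<iota>)"]) blast
  then obtain P :: "nat \<Rightarrow> ('q + 'm) cpoly" where P: "\<And>\<iota>. total_degree (P \<iota>) \<le> d"
    "\<And>\<iota> \<zeta>. poly_eval (P \<iota>) \<zeta> = Q (f \<iota>) \<zeta>"
    by metis
  have zeros: "\<zeta> \<in> common_zeros J P \<longleftrightarrow> (\<forall>b\<in>F. Q b \<zeta> = 0)" for \<zeta>
    unfolding fJ[symmetric] by (simp add: common_zeros_def P(2))
  define A1 where "A1 = real (CARD('m) * (CARD('q) + 1))"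
  \<comment> \<open>Beyond \<open>K\<close>, one of the last coordinates has modulus at least
    \<open>norm \<zeta> / (2 * A1) + C\<close>, and \<open>C\<close> is what subtracting a
    coordinate of \<open>p j\<close> can cost.\<close>
  define K where "K = 2 * (A1 * C + CARD('q))"
  \<comment> \<open>The constant of \<open>dom\<close>, with the coefficient sum bounded uniformly
    in \<alpha> and the sum over \<open>F\<close> by \<open>card F\<close> maxima; the summand 1
    makes it positive.\<close>
  define B' where "B' = B * (card (exps d :: ('q + 'm \<Rightarrow> nat) set) * (W * (R + C) ^ d)) * card F + 1"
  define \<kappa> where "\<kappa> = (1 / (2 * A1)) ^ d / B'"
  have A1: "A1 > 0" unfolding A1_def by (simp only: of_nat_0_less_iff) simp
  have K: "K > 0" using A1 C by (simp add: K_def add_nonneg_pos)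
  have B': "B' > 0" unfolding B'_def using B W R(1) C by (intro add_nonneg_pos) auto
  have \<kappa>: "\<kappa> > 0" using A1 B' by (simp add: \<kappa>_def)
  have growth: "\<kappa> * norm \<zeta> ^ d \<le> Max ((\<lambda>\<iota>. norm (poly_eval (P \<iota>) \<zeta>)) ` J)"
    if cone: "\<zeta> \<in> Gamma_cone \<epsilon>" and big: "K \<le> norm \<zeta>" for \<zeta>
  proof -
    obtain \<alpha> \<beta> where "norm \<alpha> < \<epsilon>" "norm \<beta> < \<epsilon>" "\<zeta> \<in> L \<alpha> \<beta>"
      using cone unfolding Gamma_cone_def by auto
    then have ab: "norm \<alpha> < \<epsilon>" "norm \<beta> < \<epsilon>" "intercept \<alpha> \<zeta> = \<beta>" by (simp_all add: mem_L_iff)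
    have "norm \<alpha> \<le> 1" "norm \<beta> \<le> 1" using ab \<epsilon> \<delta>2 by auto
    then obtain r where r: "norm \<zeta> \<le> A1 * norm (\<zeta> $ Inr r) + CARD('q)"
      using coordinate_growth[OF _ _ ab(3)] unfolding A1_def by blast
    \<comment> \<open>The slope is that of a plane through \<zeta>, and the linear form is its
      dominant coordinate.\<close>
    let ?a = "(\<alpha>, axis r 1)"
    have aA: "?a \<in> A" using ab by (simp add: A_def)
    have "norm (Q ?a \<zeta>) = (\<Prod>j=1..d. norm (\<zeta> $ Inr r - p j \<alpha> \<beta> $ Inr r))"
      using Q_plane[OF aA, of \<zeta>] ab \<epsilon>(2) by (simp add: lin_form_axis prod_norm)
    also have "\<dots> \<ge> (\<Prod>j=1..d. norm \<zeta> / (2 * A1))"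
    proof (intro prod_mono conjI)
      fix j assume j: "j \<in> {1..d}"
      show "0 \<le> norm \<zeta> / (2 * A1)" using A1 by simp
      have "norm (p j \<alpha> \<beta> $ Inr r) \<le> C"
        using Finite_Cartesian_Product.norm_nth_le[of "p j \<alpha> \<beta>" "Inr r"] p_bound[OF j, of \<alpha> \<beta>] ab \<epsilon>(2) \<delta>2(2)
        by linarith
      moreover have "norm \<zeta> / (2 * A1) + C \<le> norm (\<zeta> $ Inr r)"
      proof -
        have "norm \<zeta> + 2 * A1 * C \<le> 2 * A1 * norm (\<zeta> $ Inr r)"
          using r big unfolding K_def by (simp add: algebra_simps)
        then show ?thesis using A1 by (simp add: field_simps)
      qed
      ultimately show "norm \<zeta> / (2 * A1) \<le> norm (\<zeta> $ Inr r - p j \<alpha> \<beta> $ Inr r)"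
        using norm_triangle_ineq2[of "\<zeta> $ Inr r" "p j \<alpha> \<beta> $ Inr r"] by linarith
    qed
    finally have low: "(norm \<zeta> / (2 * A1)) ^ d \<le> norm (Q ?a \<zeta>)" by simp
    let ?m = "Max ((\<lambda>\<iota>. norm (poly_eval (P \<iota>) \<zeta>)) ` J)"
    have img: "(\<lambda>\<iota>. norm (poly_eval (P \<iota>) \<zeta>)) ` J = (\<lambda>b. norm (Q b \<zeta>)) ` F"
      unfolding fJ[symmetric] P(2) by (simp add: image_image)
    have m: "norm (Q b \<zeta>) \<le> ?m" if "b \<in> F" for b
      unfolding img using F(1) that by (intro Max_ge) auto
    then have m0: "?m \<ge> 0" using F(3) norm_ge_zero order.trans by blast
    have "(\<Sum>k\<in>exps d. norm (v ?a k)) \<le> (\<Sum>k\<in>(exps d :: ('q + 'm \<Rightarrow> nat) set). W * (R + C) ^ d)"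
    proof (rule sum_mono)
      fix k :: "'q + 'm \<Rightarrow> nat" assume "k \<in> exps d"
      then show "norm (v ?a k) \<le> W * (R + C) ^ d"
        using v_bound[OF aA, of "(R + C) ^ d" k] norm_G_le[of \<alpha> R] A_small[OF aA] R(2) unfolding M_def by simp
    qed
    then have 1: "(\<Sum>k\<in>exps d. norm (v ?a k)) \<le> card (exps d :: ('q + 'm \<Rightarrow> nat) set) * (W * (R + C) ^ d)"
      by simp
    have "(\<Sum>b\<in>F. norm (Q b \<zeta>)) \<le> (\<Sum>b\<in>F. ?m)" by (intro sum_mono m)
    then have 2: "(\<Sum>b\<in>F. norm (Q b \<zeta>)) \<le> card F * ?m" by simp
    have "norm (Q ?a \<zeta>) \<le> B * (card (exps d :: ('q + 'm \<Rightarrow> nat) set) * (W * (R + C) ^ d)) * (card F * ?m)"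
      using B W R(1) C by (intro order.trans[OF dom[OF aA]] mult_mono mult_left_mono 1 2) (auto intro!: sum_nonneg mult_nonneg_nonneg)
    also have "\<dots> \<le> B' * ?m" using m0 by (simp add: B'_def distrib_right)
    finally have "(norm \<zeta> / (2 * A1)) ^ d \<le> B' * ?m" using low by linarith
    then have "(norm \<zeta> / (2 * A1)) ^ d / B' \<le> ?m" by (simp only: pos_divide_le_eq[OF B'] mult.commute[of B'])
    moreover have "(norm \<zeta> / (2 * A1)) ^ d / B' = \<kappa> * norm \<zeta> ^ d"
      by (simp add: \<kappa>_def power_divide)
    ultimately show ?thesis by simp
  qed
  have "L \<alpha> \<beta> \<inter> common_zeros J P = (\<lambda>j. p j \<alpha> \<beta>) ` {1..d}" if ab: "norm \<alpha> < \<epsilon>" "norm \<beta> < \<epsilon>" for \<alpha> \<beta>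
  proof (intro equalityI subsetI)
    have ab': "norm \<alpha> < \<delta>" "norm \<beta> < \<delta>" using ab \<epsilon>(2) \<delta>2(2) by auto
    fix \<zeta>
    {
      assume "\<zeta> \<in> L \<alpha> \<beta> \<inter> common_zeros J P"
      then have \<zeta>: "intercept \<alpha> \<zeta> = \<beta>" and zero: "\<forall>b\<in>F. Q b \<zeta> = 0" by (auto simp: mem_L_iff zeros)
      show "\<zeta> \<in> (\<lambda>j. p j \<alpha> \<beta>) ` {1..d}"
      proof (rule ccontr)
        assume not: "\<zeta> \<notin> (\<lambda>j. p j \<alpha> \<beta>) ` {1..d}"
        let ?w = "\<lambda>j. (\<chi> r. \<zeta> $ Inr r - p j \<alpha> \<beta> $ Inr r)"
        have "?w j \<noteq> 0" if j: "j \<in> {1..d}" for j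
        proof
          assume "?w j = 0"
          then have r: "\<zeta> $ Inr r = p j \<alpha> \<beta> $ Inr r" for r by (simp add: vec_eq_iff)
          have "\<zeta> $ Inl k = p j \<alpha> \<beta> $ Inl k" for k
            using \<zeta> p_in_L[OF j ab'] r by (auto simp: intercept_def vec_eq_iff algebra_simps)
          then have "\<zeta> = p j \<alpha> \<beta>" using r by (metis vec_eq_iff sum.exhaust)
          then show False using not j by blast
        qed
        \<comment> \<open>One linear form keeps all d factors at \<zeta> nonzero at once.\<close>
        then obtain x where x: "\<forall>j\<in>{1..d}. (\<Sum>r\<in>UNIV. x $ r * ?w j $ r) \<noteq> 0"
          using avoid_hyperplanes[of "{1..d}" ?w] by auto
        have aA: "(\<alpha>, x) \<in> A" using ab by (simp add: A_def)
        \<comment> \<open>Vanishing on \<open>F\<close> forces \<open>Q a\<close> to vanish at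
          \<zeta> for every \<open>a\<close> in \<open>A\<close>, so also for this
          \<open>x\<close>.\<close>
        have "norm (Q (\<alpha>, x) \<zeta>) \<le> 0" using dom[OF aA, of \<zeta>] zero by simp
        then have "(\<Prod>j=1..d. lin_form x \<zeta> - lin_form x (p j \<alpha> \<beta>)) = 0"
          using Q_plane[OF aA, of \<zeta>] \<zeta> ab \<epsilon>(2) by simp
        then obtain j where "j \<in> {1..d}" "lin_form x (\<zeta> - p j \<alpha> \<beta>) = 0"
          by (auto simp: lin_form_diff)
        then show False using x by (auto simp: lin_form_def)
      qed
    next
      assume "\<zeta> \<in> (\<lambda>j. p j \<alpha> \<beta>) ` {1..d}"
      then obtain j where j: "j \<in> {1..d}" and \<zeta>: "\<zeta> = p j \<alpha> \<beta>" by blast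
      have "Q b \<zeta> = 0" if b: "b \<in> F" for b
      proof -
        \<comment> \<open>The plane of slope \<open>?\<alpha>\<close> through \<zeta> still has a
          small intercept. By uniqueness its j-th intersection point is again \<zeta>, so the j-th
          factor of \<open>Q b\<close> vanishes there.\<close>
        let ?\<alpha> = "fst b"
        have bA: "b \<in> A" using F b by blast
        have "norm (?\<alpha> - \<alpha>) \<le> \<epsilon> + \<epsilon>"
          using norm_triangle_ineq4[of ?\<alpha> \<alpha>] bA ab by (simp add: A_def)
        have "norm (act (?\<alpha> - \<alpha>) \<zeta>) \<le> real (CARD('q) * CARD('m)) * norm (?\<alpha> - \<alpha>) * norm \<zeta>"
          by (rule norm_act_le)
        also have "\<dots> \<le> M * (\<epsilon> + \<epsilon>) * C"
          using p_bound[OF j ab'] \<epsilon>(1) M \<open>norm (?\<alpha> - \<alpha>) \<le> \<epsilon> + \<epsilon>\<close> unfolding \<zeta>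
          by (intro mult_mono) (auto simp: M_def)
        finally have act: "norm (act (?\<alpha> - \<alpha>) \<zeta>) \<le> \<epsilon> * (2 * M * C)" by (simp add: algebra_simps)
        have "intercept ?\<alpha> \<zeta> = \<beta> - act (?\<alpha> - \<alpha>) \<zeta>"
          using intercept_diff_left[of \<alpha> "?\<alpha> - \<alpha>" \<zeta>] p_in_L[OF j ab'] by (simp add: \<zeta>)
        then have "norm (intercept ?\<alpha> \<zeta>) \<le> norm \<beta> + \<epsilon> * (2 * M * C)"
          using norm_triangle_ineq4[of \<beta> "act (?\<alpha> - \<alpha>) \<zeta>"] act by simp
        also have "\<dots> < \<delta>2" using ab(2) \<epsilon>(3) by (simp add: X_def algebra_simps)
        finally have small: "norm (intercept ?\<alpha> \<zeta>) < \<delta>2" .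
        have "p j ?\<alpha> (intercept ?\<alpha> \<zeta>) = \<zeta>"
          unfolding \<zeta> by (rule p_unique[OF j ab']) (use A_small[OF bA] small \<delta>2(2) \<zeta> in auto)
        then show ?thesis unfolding Q_plane[OF bA small] using j by (auto intro!: prod_zero bexI[of _ j])
      qed
      then show "\<zeta> \<in> L \<alpha> \<beta> \<inter> common_zeros J P"
        using p_in_L[OF j ab'] by (simp add: zeros mem_L_iff \<zeta>)
    }
  qed
  moreover have "finite J" "J \<noteq> {}" using F(1,3) by (auto simp: J_def card_gt_0_iff)
  ultimately show ?thesis using P(1) \<epsilon>(1) \<kappa> K growth
    by (intro exI[of _ J] exI[of _ P] exI[of _ \<epsilon>] exI[of _ \<kappa>] exI[of _ K]) simp
qed

end

section \<open>Passage from conditions near the origin to uniform balls\<close>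

theorem proposition5p2:
  fixes d D :: nat
    and \<gamma> :: "nat \<Rightarrow> (complex ^ ('q::finite + 'm::finite)) set"
    and p :: "nat \<Rightarrow> complex ^ ('q \<times> 'm) \<Rightarrow> complex ^ 'q \<Rightarrow> complex ^ ('q + 'm)"
    and h :: "'m \<Rightarrow> ('q \<Rightarrow> nat) \<Rightarrow> complex ^ ('q \<times> 'm) \<Rightarrow> complex"
    and U :: "(complex ^ ('q \<times> 'm)) set"
  assumes pieces: "\<forall>j\<in>{1..d}. complex_submanifold CARD('q) (\<gamma> j)"
    and disjoint: "disjoint_family_on \<gamma> {1..d}"
    and transversal: "\<forall>\<^sub>F (\<alpha>, \<beta>) in nhds (0, 0). \<forall>j\<in>{1..d}.
          L \<alpha> \<beta> \<inter> \<gamma> j = {p j \<alpha> \<beta>} \<and> transversal_at (\<gamma> j) (L \<alpha> \<beta>) (p j \<alpha> \<beta>)"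
    and nbhd: "open U" "0 \<in> U"
    and analytic: "\<forall>l k. (\<Sum>i\<in>UNIV. k i) \<le> D + 1 \<longrightarrow> mv_holomorphic_on (h l k) U"
    and trace: "\<forall>\<^sub>F (\<alpha>, \<beta>) in nhds (0, 0). \<forall>l.
          (\<Sum>j=1..d. p j \<alpha> \<beta> $ Inr l) =
          (\<Sum>k\<in>{k. (\<Sum>i\<in>UNIV. k i) \<le> D + 1}. h l k \<alpha> * (\<Prod>i\<in>UNIV. (\<beta> $ i) ^ k i))"
  shows "\<exists>(J :: nat set) (P :: nat \<Rightarrow> ('q + 'm) cpoly) (\<epsilon>::real) (\<kappa>::real) (K::real).
          finite J \<and> J \<noteq> {} \<and> (\<forall>\<iota>\<in>J. total_degree (P \<iota>) \<le> d + D) \<and>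
          \<epsilon> > 0 \<and> \<kappa> > 0 \<and> K > 0 \<and>
          (\<forall>\<zeta>\<in>Gamma_cone \<epsilon>. norm \<zeta> \<ge> K \<longrightarrow>
             Max ((\<lambda>\<iota>. norm (poly_eval (P \<iota>) \<zeta>)) ` J) \<ge> \<kappa> * norm \<zeta> ^ d) \<and>
          (\<forall>\<alpha> \<beta>. max (norm \<alpha>) (norm \<beta>) < \<epsilon> \<longrightarrow>
             L \<alpha> \<beta> \<inter> common_zeros J P = (\<lambda>j. p j \<alpha> \<beta>) ` {1..d})"
proof -
  define cderiv where "cderiv j x E \<longleftrightarrow> ((\<lambda>x. p j (fst x) (snd x)) has_derivative E) (at x) \<and>
      (\<forall>c a b. E (c *s a, c *s b) = c *s E (a, b))" for j x E
  define good where "good x \<longleftrightarrow> (\<forall>j\<in>{1..d}. L (fst x) (snd x) \<inter> \<gamma> j = {p j (fst x) (snd x)} \<and>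
      (\<exists>E. cderiv j x E))" for x
  have "\<forall>\<^sub>F x in nhds (0, 0). \<forall>j\<in>{1..d}. \<exists>E. cderiv j x E"
    unfolding cderiv_def
  proof (intro eventually_ball_finite ballI section_differentiable[where \<gamma> = "\<gamma> _"])
    fix j assume j: "j \<in> {1..d}"
    show "complex_submanifold CARD('q) (\<gamma> j)" using pieces j by blast
    show "\<forall>\<^sub>F (\<alpha>, \<beta>) in nhds (0, 0). L \<alpha> \<beta> \<inter> \<gamma> j = {p j \<alpha> \<beta>} \<and> transversal_at (\<gamma> j) (L \<alpha> \<beta>) (p j \<alpha> \<beta>)"
      by (rule eventually_mono[OF transversal]) (use j in auto)
  qed simp
  with transversal have good: "\<forall>\<^sub>F x in nhds (0, 0). good x"
    by eventually_elim (simp add: good_def split_beta)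
  have good0: "good (0, 0)" by (rule eventually_nhds_x_imp_x[OF good])
  \<comment> \<open>The sum serves as a common bound for all \<open>j\<close>.\<close>
  define C where "C = (\<Sum>j=1..d. norm (p j 0 0) + 1)"
  have "\<forall>\<^sub>F x in nhds (0, 0). \<forall>j\<in>{1..d}. norm (p j (fst x) (snd x)) < norm (p j 0 0) + 1"
  proof (intro eventually_ball_finite ballI)
    fix j assume j: "j \<in> {1..d}"
    obtain E where "((\<lambda>x. p j (fst x) (snd x)) has_derivative E) (at (0, 0))"
      using good0 j unfolding good_def cderiv_def by blast
    then have "isCont (\<lambda>x. p j (fst x) (snd x)) (0, 0)" by (rule has_derivative_continuous)
    then have "((\<lambda>x. p j (fst x) (snd x)) \<longlongrightarrow> p j 0 0) (nhds (0, 0))"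
      using tendsto_at_iff_tendsto_nhds[of "\<lambda>x. p j (fst x) (snd x)" "(0, 0)"] by (simp add: isCont_def)
    then have "((\<lambda>x. norm (p j (fst x) (snd x))) \<longlongrightarrow> norm (p j 0 0)) (nhds (0, 0))"
      by (rule tendsto_norm)
    then show "\<forall>\<^sub>F x in nhds (0, 0). norm (p j (fst x) (snd x)) < norm (p j 0 0) + 1"
      by (rule order_tendstoD(2)) simp
  qed simp
  with good trace have "\<forall>\<^sub>F x in nhds (0, 0). good x \<and>
      (\<forall>j\<in>{1..d}. norm (p j (fst x) (snd x)) < norm (p j 0 0) + 1) \<and>
      (\<forall>l. (\<Sum>j=1..d. p j (fst x) (snd x) $ Inr l) =
        (\<Sum>k\<in>exps (D + 1). h l k (fst x) * mono_eval (snd x) k))"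
    by eventually_elim (auto simp: exps_def mono_eval_def)
  then obtain e where e: "e > 0" and near: "\<And>x. dist x (0, 0) < e \<Longrightarrow> good x \<and>
      (\<forall>j\<in>{1..d}. norm (p j (fst x) (snd x)) < norm (p j 0 0) + 1) \<and>
      (\<forall>l. (\<Sum>j=1..d. p j (fst x) (snd x) $ Inr l) =
        (\<Sum>k\<in>exps (D + 1). h l k (fst x) * mono_eval (snd x) k))"
    unfolding eventually_nhds_metric by blast
  \<comment> \<open>The product of two balls of radius \<open>e / 2\<close> fits into the ball of
    radius \<open>e\<close> of the product space.\<close>
  have close: "dist (\<alpha>, \<beta>) (0, 0) < e" if "norm \<alpha> < e / 2" "norm \<beta> < e / 2" for \<alpha> \<beta>
  proof -
    have "dist (\<alpha>, \<beta>) (0, 0) \<le> norm \<alpha> + norm \<beta>"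
      by (simp add: dist_norm norm_Pair sqrt_sum_squares_le_sum)
    then show ?thesis using that by linarith
  qed
  have sect: "L \<alpha> \<beta> \<inter> \<gamma> j = {p j \<alpha> \<beta>}"
    if "j \<in> {1..d}" "norm \<alpha> < e / 2" "norm \<beta> < e / 2" for j \<alpha> \<beta>
    using near[OF close[OF that(2,3)]] that(1) unfolding good_def by simp
  define DD where "DD j \<alpha> \<beta> = (SOME E. cderiv j (\<alpha>, \<beta>) E)" for j \<alpha> \<beta>
  have DD: "cderiv j (\<alpha>, \<beta>) (DD j \<alpha> \<beta>)"
    if "j \<in> {1..d}" "norm \<alpha> < e / 2" "norm \<beta> < e / 2" for j \<alpha> \<beta>
    unfolding DD_def using near[OF close[OF that(2,3)]] that(1)
    by (intro someI_ex[of "cderiv j (\<alpha>, \<beta>)"]) (simp add: good_def)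
  interpret plane_sections d D "e / 2" C p h DD
  proof
    show "e / 2 > 0" using e by simp
    show "C \<ge> 0" unfolding C_def by (intro sum_nonneg) auto
    fix \<alpha> :: "complex ^ ('q \<times> 'm)" and \<beta> :: "complex ^ 'q"
    assume a: "norm \<alpha> < e / 2" and b: "norm \<beta> < e / 2"
    show "(\<Sum>j=1..d. p j \<alpha> \<beta> $ Inr r) = (\<Sum>k\<in>exps (D + 1). h r k \<alpha> * mono_eval \<beta> k)" for r
      using near[OF close[OF a b]] unfolding fst_conv snd_conv by blast
    fix j assume j: "j \<in> {1..d}"
    show "intercept \<alpha> (p j \<alpha> \<beta>) = \<beta>" unfolding mem_L_iff[symmetric] using sect[OF j a b] by blast
    show "norm (p j \<alpha> \<beta>) \<le> C"
    proof -
      have "norm (p j \<alpha> \<beta>) \<le> norm (p j 0 0) + 1"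
        using near[OF close[OF a b]] j unfolding fst_conv snd_conv by (blast intro: less_imp_le)
      also have "\<dots> \<le> C" unfolding C_def using j by (intro member_le_sum) auto
      finally show ?thesis .
    qed
    show "((\<lambda>x. p j (fst x) (snd x)) has_derivative DD j \<alpha> \<beta>) (at (\<alpha>, \<beta>))"
      using DD[OF j a b] unfolding cderiv_def by blast
    show "DD j \<alpha> \<beta> (c *s a', c *s b') = c *s DD j \<alpha> \<beta> (a', b')" for c a' b'
      using DD[OF j a b] unfolding cderiv_def by blast
    show "p j \<alpha>' \<beta>' = p j \<alpha> \<beta>"
      if "norm \<alpha>' < e / 2" "norm \<beta>' < e / 2" "intercept \<alpha>' (p j \<alpha> \<beta>) = \<beta>'" for \<alpha>' \<beta>'
    proof -
      have "p j \<alpha> \<beta> \<in> \<gamma> j" using sect[OF j a b] by blast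
      moreover have "p j \<alpha> \<beta> \<in> L \<alpha>' \<beta>'" using that(3) by (simp add: mem_L_iff)
      ultimately have "p j \<alpha> \<beta> \<in> L \<alpha>' \<beta>' \<inter> \<gamma> j" by blast
      then show ?thesis unfolding sect[OF j that(1,2)] by simp
    qed
  qed
  \<comment> \<open>The degree bound \<open>d\<close> is weakened to \<open>d + D\<close>.\<close>
  show ?thesis using defining_polynomials
    by (elim ex_forward conj_forward) (assumption | simp add: trans_le_add1)+
qed

end
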